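(* In the two-item setting with type set $\Theta=\Theta_1\sqcup\Theta_2$ and prior $\boldsymbol\lambda$ described in the context, let $m_\theta^{\mathrm{AE}}$ be the margin of the algorithm's classifier from the perspective of user type $\theta$ when all other user types follow the equilibrium strategy under algorithmic entry. Define the steerable sets $$\theta\in\Theta_1:\quad F_\theta:=\Big\{x\in\big[0,\tfrac{\alpha_\theta(a)}{\alpha_\theta(b)}\big)\ \Big|\ \frac{\lambda_\theta}{\alpha_\theta(b)}-m_\theta^{\mathrm{AE}}-x\Big(\frac{\lambda_\theta}{\alpha_\theta(a)}-\gamma_{\mathcal A}m_\theta^{\mathrm{AE}}\Big)\ge0\Big\},$$ $$\theta\in\Theta_2:\quad F_\theta:=\Big\{x\in[0,1]\ \Big|\ \frac{\lambda_\theta}{\alpha_\theta(a)}+m_\theta^{\mathrm{AE}}-x\Big(\frac{\lambda_\theta}{\alpha_\theta(b)}+\gamma_{\mathcal A}m_\theta^{\mathrm{AE}}\Big)\ge0\Big\}.$$ Let $s^*_\theta$ and $-s^*_\theta$ be the high- and low-reward items for type $\theta$. Then the user's strategy at equilibrium is $f_\theta^{\mathrm{AE}}(s^*_\theta)=1$ and $$f_\theta^{\mathrm{AE}}(-s^*_\theta)=\begin{cases}\text{any value in }F_\theta, & F_\theta\neq\emptyset,\\ 0, & F_\theta=\emptyset,\ \gamma_{\mathcal H}>\frac{r_\theta(-s^*_\theta)}{r_\theta(s^*_\theta)},\\ 1, & F_\theta=\emptyset,\ \gamma_{\mathcal H}<\frac{r_\theta(-s^*_\theta)}{r_\theta(s^*_\theta)},\\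 \text{any value in }[0,1], & F_\theta=\emptyset,\ \gamma_{\mathcal H}=\frac{r_\theta(-s^*_\theta)}{r_\theta(s^*_\theta)}.\end{cases}$$
   Context: Setting. $\Theta$ is a finite set of user types, partitioned as $\Theta=\Theta_1\sqcup\Theta_2$, and $S=\{a,b\}$ is the set of items; $-s$ denotes the item other than $s$. For each $\theta\in\Theta$, $s\in S$ there are $\alpha_\theta(s)>0$ and an expected reward $r_\theta(s)\in\mathbb R$. For all $\theta$: $1/\alpha_\theta(a)>1/\alpha_\theta(b)$. For $\theta\in\Theta_1$: $r_\theta(a)<r_\theta(b)$ (so $s^*_\theta=b$). For $\theta\in\Theta_2$: $r_\theta(a)>r_\theta(b)$ (so $s^*_\theta=a$). The algorithm's discount factor is $\gamma_{\mathcal A}\in[0,1)$ and the users' discount factor is $\gamma_{\mathcal H}\in[0,1)$. $\boldsymbol\lambda=(\lambda_\theta)$ is a commonly known prior on $\Theta$. Interaction. A session involves one user of a fixed type $\theta$. At each step the algorithm recommends an item $s$; the user engages with probability $f_\theta(s)\in[0,1]$ (independently across steps). If she engages, the engagement length $y>0$ has mean $1/\alpha_\theta(s)$ and the user receives expected reward $r_\theta(s)$; otherwise $y=0$ and she receives nothing. The algorithm acts on only $\hat y=\mathbf 1\{y>0\}$, and knows the profile $\mathbf f=(f_\theta)_{\theta\in\Theta}$. $[\boldsymbol\lambda\mid(s,\hat y);\mathbf f]$ is the Bayes posterior, proportional to $\lambda_\theta f_\theta(s)$ if $\hat y=1$ and to $\lambda_\theta(1-f_\theta(s))$ if $\hat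 y=0$. Algorithm. $Q_{\mathcal A}(\boldsymbol\lambda,s;\mathbf f)$ is the maximum over recommendation policies of $\mathbb E[\sum_{t\ge1}\gamma_{\mathcal A}^{t-1}y_t]$ when $\theta\sim\boldsymbol\lambda$ and the first item is $s$; it satisfies $$Q_{\mathcal A}(\boldsymbol\lambda,s;\mathbf f)=\mathbb E_{\theta\sim\boldsymbol\lambda}\Big[\tfrac{f_\theta(s)}{\alpha_\theta(s)}+\gamma_{\mathcal A}\mathbb E_{\hat y\sim\mathrm{Ber}(f_\theta(s))}\max_{s'}Q_{\mathcal A}([\boldsymbol\lambda\mid(s,\hat y);\mathbf f],s';\mathbf f)\Big].$$ At each step the algorithm recommends an item maximizing $Q_{\mathcal A}$ at its current posterior; when taking the argmax one may assume that any item maximizing $Q_{\mathcal A}$ is chosen. Users. With the algorithm best responding to $\mathbf f$, type $\theta$'s value starting from posterior $\boldsymbol\lambda$ and item $s$ is $$Q_\theta(\boldsymbol\lambda,s;\mathbf f)=f_\theta(s)r_\theta(s)+\gamma_{\mathcal H}\mathbb E_{\hat y\sim\mathrm{Ber}(f_\theta(s))}Q_\theta\big([\boldsymbol\lambda\mid(s,\hat y);\mathbf f],\ \arg\max_{s'}Q_{\mathcal A}([\boldsymbol\lambda\mid(s,\hat y);\mathbf f],s';\mathbf f);\ \mathbf f\big).$$ Standing restrictions on strategies. For every $\theta$, $f_\theta(s^*_\theta)=1$, and for every $s$, $f_\theta(s)\in[0,\alpha_\theta(s)/\alpha_\theta(s^*_\theta))\cup\{1\}$ (and $f_\theta(s)\in[0,1]$).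 Equilibrium under algorithmic entry (AE). The algorithm chooses the first item, $s_1\in\arg\max_sQ_{\mathcal A}(\boldsymbol\lambda,s;\mathbf f)$. A profile $\mathbf f^{\mathrm{AE}}$ is an equilibrium if for every $\theta$, $f_\theta^{\mathrm{AE}}$ maximizes, over $f_\theta$, the quantity $Q_\theta(\boldsymbol\lambda,\arg\max_sQ_{\mathcal A}(\boldsymbol\lambda,s;\mathbf g);\mathbf g)$ with $\mathbf g=(f_\theta,\mathbf f^{\mathrm{AE}}_{-\theta})$ (the algorithm best responds to the deviated profile). Margin. For a profile $\mathbf f$ let $$h_\theta=\frac{1-\gamma_{\mathcal A}}{(1-\gamma_{\mathcal A}f_\theta(a))(1-\gamma_{\mathcal A}f_\theta(b))}\Big[\frac{f_\theta(a)}{\alpha_\theta(a)}-\frac{f_\theta(b)}{\alpha_\theta(b)}\Big];$$ the algorithm's best response is the linear classifier that favors $a$ according to the sign of $\sum_\theta h_\theta\lambda_\theta$. The margin from the perspective of $\theta$ is $m_\theta=\sum_{\theta'\in\Theta\setminus\{\theta\}}h_{\theta'}\lambda_{\theta'}$, and $m_\theta^{\mathrm{AE}}$ is its value when the other types play $\mathbf f^{\mathrm{AE}}_{-\theta}$.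
   Formalization: The high-item reward is assumed positive for every type; for types in Θ₁ with nonempty F the value 1 is also allowed when F's inequality holds at x=1; "any value in [0,1]" is subject to the standing restrictions; ties are resolved in the user's favor. *)

theory Defs
  imports "HOL-Probability.Probability"
begin

datatype item = ItemA | ItemB

fun other :: "item \<Rightarrow> item" where
  "other ItemA = ItemB"
| "other ItemB = ItemA"

type_synonym strategy = "item \<Rightarrow> real"
type_synonym 'u profile = "'u \<Rightarrow> strategy"
type_synonym 'u belief = "'u \<Rightarrow> real"

text \<open>A history lists the recommended items, oldest first, each with the flag telling whether the
  user engaged. A recommendation policy chooses the next item as a function of the history.\<close>

type_synonym history = "(item \<times> bool) list"
type_synonym policy = "history \<Rightarrow> item"

text \<open>The distribution of the history after \<open>t\<close> recommendations, when the user engages with item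
  \<open>s\<close> with probability \<open>\<phi> s\<close>, independently across steps.\<close>

primrec history_pmf :: "strategy \<Rightarrow> policy \<Rightarrow> nat \<Rightarrow> history pmf" where
  "history_pmf \<phi> \<pi> 0 = return_pmf []"
| "history_pmf \<phi> \<pi> (Suc t) =
     bind_pmf (history_pmf \<phi> \<pi> t)
       (\<lambda>h. map_pmf (\<lambda>y. h @ [(\<pi> h, y)]) (bernoulli_pmf (\<phi> (\<pi> h))))"

text \<open>Expected payoff of the step that follows \<open>t\<close> earlier ones, when an engagement with item \<open>s\<close>
  is worth \<open>w s\<close> in expectation and a missing engagement is worth nothing.\<close>

definition step_payoff :: "strategy \<Rightarrow> (item \<Rightarrow> real) \<Rightarrow> policy \<Rightarrow> nat \<Rightarrow> real" where
  "step_payoff \<phi> w \<pi> t =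
     measure_pmf.expectation (history_pmf \<phi> \<pi> t) (\<lambda>h. \<phi> (\<pi> h) * w (\<pi> h))"

definition session_value :: "real \<Rightarrow> strategy \<Rightarrow> (item \<Rightarrow> real) \<Rightarrow> policy \<Rightarrow> real" where
  "session_value \<gamma> \<phi> w \<pi> = (\<Sum>t. \<gamma> ^ t * step_payoff \<phi> w \<pi> t)"

text \<open>Bayes posterior. When the observation has probability zero, division by zero makes this the
  zero vector, at which both items are optimal for the algorithm.\<close>

definition posterior :: "'u::finite profile \<Rightarrow> 'u belief \<Rightarrow> item \<times> bool \<Rightarrow> 'u belief" where
  "posterior f \<mu> = (\<lambda>(s, y) \<theta>.
     \<mu> \<theta> * (if y then f \<theta> s else 1 - f \<theta> s) /
     (\<Sum>\<theta>'\<in>UNIV. \<mu> \<theta>' * (if y then f \<theta>' s else 1 - f \<theta>' s)))"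

definition posterior_after :: "'u::finite profile \<Rightarrow> 'u belief \<Rightarrow> history \<Rightarrow> 'u belief" where
  "posterior_after f \<mu> h = foldl (posterior f) \<mu> h"

text \<open>The algorithm's payoff of an engagement of type \<open>\<theta>\<close> with item \<open>s\<close> is its mean length
  \<open>1 / \<alpha> \<theta> s\<close>.\<close>

definition Q_alg :: "('u::finite \<Rightarrow> item \<Rightarrow> real) \<Rightarrow> real \<Rightarrow> 'u profile \<Rightarrow> 'u belief \<Rightarrow> item \<Rightarrow> real" where
  "Q_alg \<alpha> \<gamma>A f \<mu> s =
     (SUP \<pi>\<in>{\<pi>. \<pi> [] = s}. \<Sum>\<theta>\<in>UNIV. \<mu> \<theta> * session_value \<gamma>A (f \<theta>) (\<lambda>s'. 1 / \<alpha> \<theta> s') \<pi>)"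

definition best_items :: "('u::finite \<Rightarrow> item \<Rightarrow> real) \<Rightarrow> real \<Rightarrow> 'u profile \<Rightarrow> 'u belief \<Rightarrow> item set" where
  "best_items \<alpha> \<gamma>A f \<mu> = {s. \<forall>s'. Q_alg \<alpha> \<gamma>A f \<mu> s' \<le> Q_alg \<alpha> \<gamma>A f \<mu> s}"

text \<open>The value of type \<open>\<theta>\<close> when the algorithm starts with item \<open>s\<close> and best responds afterwards.
  If both items maximize the algorithm's value, the user may assume that either of them is chosen:
  her value is the supremum over all resolutions of the ties. The resulting recursion is \<open>Q_user_rec\<close> below.\<close>

definition Q_user ::
  "('u::finite \<Rightarrow> item \<Rightarrow> real) \<Rightarrow> ('u \<Rightarrow> item \<Rightarrow> real) \<Rightarrow> real \<Rightarrow> real \<Rightarrow> 'u profile \<Rightarrow> 'u \<Rightarrow> 'u belief \<Rightarrow> item \<Rightarrow> real"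
where
  "Q_user \<alpha> r \<gamma>A \<gamma>H f \<theta> \<mu> s =
     (SUP \<pi>\<in>{\<pi>. \<pi> [] = s \<and> (\<forall>h. h \<noteq> [] \<longrightarrow> \<pi> h \<in> best_items \<alpha> \<gamma>A f (posterior_after f \<mu> h))}.
        session_value \<gamma>H (f \<theta>) (r \<theta>) \<pi>)"

definition Q_entry ::
  "('u::finite \<Rightarrow> item \<Rightarrow> real) \<Rightarrow> ('u \<Rightarrow> item \<Rightarrow> real) \<Rightarrow> real \<Rightarrow> real \<Rightarrow> 'u profile \<Rightarrow> 'u \<Rightarrow> 'u belief \<Rightarrow> real"
where
  "Q_entry \<alpha> r \<gamma>A \<gamma>H f \<theta> \<mu> = (SUP s\<in>best_items \<alpha> \<gamma>A f \<mu>. Q_user \<alpha> r \<gamma>A \<gamma>H f \<theta> \<mu> s)"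

text \<open>The high-reward item; rewards are assumed to differ.\<close>

definition high_item :: "('u \<Rightarrow> item \<Rightarrow> real) \<Rightarrow> 'u \<Rightarrow> item" where
  "high_item r \<theta> = (if r \<theta> ItemA < r \<theta> ItemB then ItemB else ItemA)"

abbreviation low_item :: "('u \<Rightarrow> item \<Rightarrow> real) \<Rightarrow> 'u \<Rightarrow> item" where
  "low_item r \<theta> \<equiv> other (high_item r \<theta>)"

definition admissible :: "('u \<Rightarrow> item \<Rightarrow> real) \<Rightarrow> ('u \<Rightarrow> item \<Rightarrow> real) \<Rightarrow> 'u \<Rightarrow> strategy \<Rightarrow> bool" where
  "admissible \<alpha> r \<theta> \<phi> \<longleftrightarrow>
     \<phi> (high_item r \<theta>) = 1 \<and>
     (\<forall>s. \<phi> s \<in> {0..1} \<and> \<phi> s \<in> {0..<\<alpha> \<theta> s / \<alpha> \<theta> (high_item r \<theta>)} \<union> {1})"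

definition AE_equilibrium ::
  "('u::finite \<Rightarrow> item \<Rightarrow> real) \<Rightarrow> ('u \<Rightarrow> item \<Rightarrow> real) \<Rightarrow> real \<Rightarrow> real \<Rightarrow> 'u belief \<Rightarrow> 'u profile \<Rightarrow> bool"
where
  "AE_equilibrium \<alpha> r \<gamma>A \<gamma>H \<mu> f \<longleftrightarrow>
     (\<forall>\<theta>. admissible \<alpha> r \<theta> (f \<theta>)) \<and>
     (\<forall>\<theta> \<phi>. admissible \<alpha> r \<theta> \<phi> \<longrightarrow>
        Q_entry \<alpha> r \<gamma>A \<gamma>H (f(\<theta> := \<phi>)) \<theta> \<mu> \<le> Q_entry \<alpha> r \<gamma>A \<gamma>H f \<theta> \<mu>)"

definition classifier_weight :: "('u \<Rightarrow> item \<Rightarrow> real) \<Rightarrow> real \<Rightarrow> 'u profile \<Rightarrow> 'u \<Rightarrow> real" where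
  "classifier_weight \<alpha> \<gamma>A f \<theta> =
     (1 - \<gamma>A) / ((1 - \<gamma>A * f \<theta> ItemA) * (1 - \<gamma>A * f \<theta> ItemB)) *
     (f \<theta> ItemA / \<alpha> \<theta> ItemA - f \<theta> ItemB / \<alpha> \<theta> ItemB)"

definition margin :: "('u::finite \<Rightarrow> item \<Rightarrow> real) \<Rightarrow> real \<Rightarrow> 'u belief \<Rightarrow> 'u profile \<Rightarrow> 'u \<Rightarrow> real" where
  "margin \<alpha> \<gamma>A \<mu> f \<theta> = (\<Sum>\<theta>'\<in>UNIV - {\<theta>}. classifier_weight \<alpha> \<gamma>A f \<theta>' * \<mu> \<theta>')"

text \<open>The affine functions whose nonnegativity cuts out the steerable sets. For \<open>\<theta> \<in> \<Theta>1\<close> playing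
  \<open>x\<close> on the low item, \<open>slack1\<close> is \<open>- (1 - \<gamma>A * x)\<close> times the full classifier sum, so it is
  nonnegative iff the algorithm weakly favors \<open>ItemB\<close>; this holds at \<open>x = 1\<close> too, a value which the
  steerable set of a type in \<open>\<Theta>1\<close> leaves out.\<close>

definition slack1 :: "('u::finite \<Rightarrow> item \<Rightarrow> real) \<Rightarrow> real \<Rightarrow> 'u belief \<Rightarrow> 'u profile \<Rightarrow> 'u \<Rightarrow> real \<Rightarrow> real" where
  "slack1 \<alpha> \<gamma>A \<mu> f \<theta> x =
     \<mu> \<theta> / \<alpha> \<theta> ItemB - margin \<alpha> \<gamma>A \<mu> f \<theta> - x * (\<mu> \<theta> / \<alpha> \<theta> ItemA - \<gamma>A * margin \<alpha> \<gamma>A \<mu> f \<theta>)"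

definition slack2 :: "('u::finite \<Rightarrow> item \<Rightarrow> real) \<Rightarrow> real \<Rightarrow> 'u belief \<Rightarrow> 'u profile \<Rightarrow> 'u \<Rightarrow> real \<Rightarrow> real" where
  "slack2 \<alpha> \<gamma>A \<mu> f \<theta> x =
     \<mu> \<theta> / \<alpha> \<theta> ItemA + margin \<alpha> \<gamma>A \<mu> f \<theta> - x * (\<mu> \<theta> / \<alpha> \<theta> ItemB + \<gamma>A * margin \<alpha> \<gamma>A \<mu> f \<theta>)"

definition steerable ::
  "'u set \<Rightarrow> ('u::finite \<Rightarrow> item \<Rightarrow> real) \<Rightarrow> real \<Rightarrow> 'u belief \<Rightarrow> 'u profile \<Rightarrow> 'u \<Rightarrow> real set"
where
  "steerable \<Theta>1 \<alpha> \<gamma>A \<mu> f \<theta> =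
     (if \<theta> \<in> \<Theta>1
      then {x \<in> {0..<\<alpha> \<theta> ItemA / \<alpha> \<theta> ItemB}. 0 \<le> slack1 \<alpha> \<gamma>A \<mu> f \<theta> x}
      else {x \<in> {0..1}. 0 \<le> slack2 \<alpha> \<gamma>A \<mu> f \<theta> x})"

text \<open>The values defined above as suprema over policies satisfy the Bellman recursions
  \<open>Q_alg_rec\<close> and \<open>Q_user_rec\<close>.\<close>

definition continue_after :: "policy \<Rightarrow> item \<times> bool \<Rightarrow> policy" where
  "continue_after \<pi> o1 = (\<lambda>h. \<pi> (o1 # h))"

lemma history_pmf_Suc_first:
  "history_pmf \<phi> \<pi> (Suc t) =
     bind_pmf (bernoulli_pmf (\<phi> (\<pi> [])))
       (\<lambda>y. map_pmf ((#) (\<pi> [], y)) (history_pmf \<phi> (continue_after \<pi> (\<pi> [], y)) t))"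
proof (induction t)
  case 0
  show ?case by (simp add: map_pmf_def bind_return_pmf)
next
  case (Suc t)
  show ?case
    by (subst history_pmf.simps(2), subst Suc.IH)
       (simp add: bind_assoc_pmf map_pmf_def bind_return_pmf continue_after_def)
qed

lemma finite_history: "finite (set_pmf (history_pmf \<phi> \<pi> t))"
  by (induction t) auto

lemma step_payoff_0: "step_payoff \<phi> w \<pi> 0 = \<phi> (\<pi> []) * w (\<pi> [])"
  by (simp add: step_payoff_def)

lemma step_payoff_Suc:
  assumes "\<phi> (\<pi> []) \<in> {0..1}"
  shows "step_payoff \<phi> w \<pi> (Suc t) =
     \<phi> (\<pi> []) * step_payoff \<phi> w (continue_after \<pi> (\<pi> [], True)) t +
     (1 - \<phi> (\<pi> [])) * step_payoff \<phi> w (continue_after \<pi> (\<pi> [], False)) t"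
proof -
  let ?g = "\<lambda>\<pi> h. \<phi> (\<pi> h) * w (\<pi> h)"
  have "step_payoff \<phi> w \<pi> (Suc t) =
     measure_pmf.expectation (bind_pmf (bernoulli_pmf (\<phi> (\<pi> [])))
       (\<lambda>y. map_pmf ((#) (\<pi> [], y)) (history_pmf \<phi> (continue_after \<pi> (\<pi> [], y)) t))) (?g \<pi>)"
    unfolding step_payoff_def history_pmf_Suc_first ..
  also have "\<dots> = (\<Sum>y\<in>UNIV. pmf (bernoulli_pmf (\<phi> (\<pi> []))) y *\<^sub>R
      measure_pmf.expectation (map_pmf ((#) (\<pi> [], y)) (history_pmf \<phi> (continue_after \<pi> (\<pi> [], y)) t)) (?g \<pi>))"
    by (rule pmf_expectation_bind) (auto simp: finite_history)
  also have "\<dots> = \<phi> (\<pi> []) * step_payoff \<phi> w (continue_after \<pi> (\<pi> [], True)) t +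
     (1 - \<phi> (\<pi> [])) * step_payoff \<phi> w (continue_after \<pi> (\<pi> [], False)) t"
    using assms by (simp add: UNIV_bool step_payoff_def continue_after_def)
  finally show ?thesis .
qed

lemma step_payoff_bound:
  assumes "\<And>s. \<phi> s \<in> {0..1}" "\<And>s. \<bar>w s\<bar> \<le> W"
  shows "\<bar>step_payoff \<phi> w \<pi> t\<bar> \<le> W"
proof -
  have b: "\<bar>\<phi> s * w s\<bar> \<le> W" for s
  proof -
    have "\<bar>\<phi> s\<bar> * \<bar>w s\<bar> \<le> 1 * W" using assms[of s] by (intro mult_mono) auto
    then show ?thesis by (simp add: abs_mult)
  qed
  have "\<bar>step_payoff \<phi> w \<pi> t\<bar> \<le> measure_pmf.expectation (history_pmf \<phi> \<pi> t) (\<lambda>h. \<bar>\<phi> (\<pi> h) * w (\<pi> h)\<bar>)"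
    unfolding step_payoff_def by (rule integral_abs_bound)
  also have "\<dots> \<le> W"
    by (rule measure_pmf.integral_le_const) (auto simp: b intro!: integrable_measure_pmf_finite finite_history)
  finally show ?thesis .
qed

lemma session_summable:
  assumes "0 \<le> \<gamma>" "\<gamma> < 1" "\<And>s. \<phi> s \<in> {0..1}"
  shows "summable (\<lambda>t. \<gamma> ^ t * step_payoff \<phi> w \<pi> t)"
proof -
  define W where "W = max \<bar>w ItemA\<bar> \<bar>w ItemB\<bar>"
  have W: "\<bar>w s\<bar> \<le> W" for s by (cases s) (auto simp: W_def)
  show ?thesis
  proof (rule summable_comparison_test')
    show "summable (\<lambda>t. \<gamma> ^ t * W)" using assms by (intro summable_mult2 summable_geometric) auto
    show "norm (\<gamma> ^ t * step_payoff \<phi> w \<pi> t) \<le> \<gamma> ^ t * W" for t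
      using step_payoff_bound[of \<phi> w W \<pi> t, OF assms(3) W] assms
      by (simp add: abs_mult mult_left_mono)
  qed
qed

lemma session_bound:
  assumes "0 \<le> \<gamma>" "\<gamma> < 1" "\<And>s. \<phi> s \<in> {0..1}" "\<And>s. \<bar>w s\<bar> \<le> W"
  shows "\<bar>session_value \<gamma> \<phi> w \<pi>\<bar> \<le> W / (1 - \<gamma>)"
proof -
  have "norm (\<Sum>t. \<gamma> ^ t * step_payoff \<phi> w \<pi> t) \<le> (\<Sum>t. \<gamma> ^ t * W)"
  proof (rule norm_suminf_le)
    show "norm (\<gamma> ^ t * step_payoff \<phi> w \<pi> t) \<le> \<gamma> ^ t * W" for t
      using step_payoff_bound[of \<phi> w W \<pi> t, OF assms(3,4)] assms(1)
      by (simp add: abs_mult mult_left_mono)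
    show "summable (\<lambda>t. \<gamma> ^ t * W)" using assms by (intro summable_mult2 summable_geometric) auto
  qed
  also have "(\<Sum>t. \<gamma> ^ t * W) = W / (1 - \<gamma>)"
    using assms by (subst suminf_mult2[symmetric]) (auto simp: suminf_geometric)
  finally show ?thesis by (simp add: session_value_def)
qed

lemma session_value_rec:
  assumes "0 \<le> \<gamma>" "\<gamma> < 1" "\<And>s. \<phi> s \<in> {0..1}"
  shows "session_value \<gamma> \<phi> w \<pi> = \<phi> (\<pi> []) * w (\<pi> []) + \<gamma> *
     (\<phi> (\<pi> []) * session_value \<gamma> \<phi> w (continue_after \<pi> (\<pi> [], True)) +
      (1 - \<phi> (\<pi> [])) * session_value \<gamma> \<phi> w (continue_after \<pi> (\<pi> [], False)))"
proof -
  note S = session_summable[OF assms]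
  let ?p = "\<phi> (\<pi> [])"
  let ?T = "\<lambda>t. step_payoff \<phi> w (continue_after \<pi> (\<pi> [], True)) t"
  let ?F = "\<lambda>t. step_payoff \<phi> w (continue_after \<pi> (\<pi> [], False)) t"
  have "session_value \<gamma> \<phi> w \<pi> = step_payoff \<phi> w \<pi> 0 + (\<Sum>t. \<gamma> ^ Suc t * step_payoff \<phi> w \<pi> (Suc t))"
    unfolding session_value_def using suminf_split_head[OF S[where w = w and \<pi> = \<pi>]] by simp
  also have "(\<Sum>t. \<gamma> ^ Suc t * step_payoff \<phi> w \<pi> (Suc t)) =
      (\<Sum>t. \<gamma> * ?p * (\<gamma> ^ t * ?T t) + \<gamma> * (1 - ?p) * (\<gamma> ^ t * ?F t))"
    by (subst step_payoff_Suc[OF assms(3)]) (simp add: algebra_simps)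
  also have "\<dots> = \<gamma> * ?p * (\<Sum>t. \<gamma> ^ t * ?T t) + \<gamma> * (1 - ?p) * (\<Sum>t. \<gamma> ^ t * ?F t)"
    by (subst suminf_add[symmetric])
       (intro summable_mult S, intro summable_mult S, simp only: suminf_mult[OF S])
  finally show ?thesis by (simp add: session_value_def step_payoff_0 algebra_simps)
qed


lemma best_items_nonempty: "best_items \<alpha> \<gamma>A f \<mu> \<noteq> {}"
proof -
  let ?q = "Q_alg \<alpha> \<gamma>A f \<mu>"
  have "(\<forall>s'. ?q s' \<le> ?q ItemA) \<or> (\<forall>s'. ?q s' \<le> ?q ItemB)"
    by (metis item.exhaust linorder_linear order_refl)
  then show ?thesis by (auto simp: best_items_def)
qed

lemma weighted_cSup_le:
  fixes U V :: "real set"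
  assumes "U \<noteq> {}" "V \<noteq> {}" "0 \<le> p" "0 \<le> q"
    and le: "\<And>u v. u \<in> U \<Longrightarrow> v \<in> V \<Longrightarrow> p * u + q * v \<le> M"
  shows "p * Sup U + q * Sup V \<le> M"
proof -
  have *: "p * Sup U + q * v \<le> M" if v: "v \<in> V" for v
  proof (cases "p = 0")
    case True
    then show ?thesis using le[OF _ v] assms(1) by auto
  next
    case False
    then have p: "p > 0" using assms by simp
    have "Sup U \<le> (M - q * v) / p"
      using le[OF _ v] p by (intro cSup_least assms(1)) (simp add: field_simps)
    then show ?thesis using p by (simp add: field_simps)
  qed
  show ?thesis
  proof (cases "q = 0")
    case True
    then show ?thesis using * assms(2) by auto
  next
    case False
    then have q: "q > 0" using assms by simp
    have "Sup V \<le> (M - p * Sup U) / q"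
      using * q by (intro cSup_least assms(2)) (simp add: field_simps)
    then show ?thesis using q by (simp add: field_simps)
  qed
qed

lemma cSUP_split:
  fixes J :: "'b \<Rightarrow> real"
  assumes "B \<noteq> {}" "\<And>s. s \<in> B \<Longrightarrow> P s \<noteq> {}" "\<And>x. \<bar>J x\<bar> \<le> K"
  shows "(SUP s\<in>B. SUP x\<in>P s. J x) = (SUP x\<in>(\<Union>s\<in>B. P s). J x)"
proof -
  have bd: "bdd_above (J ` X)" for X
    using assms(3) by (intro bdd_aboveI2[where M = K]) (meson abs_le_D1)
  have inner: "(SUP x\<in>P s. J x) \<le> K" if "s \<in> B" for s
    using assms that by (intro cSUP_least) (auto intro: abs_le_D1)
  have bd2: "bdd_above ((\<lambda>s. SUP x\<in>P s. J x) ` B)"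
    using inner by (intro bdd_aboveI2)
  show ?thesis
  proof (rule antisym)
    show "(SUP s\<in>B. SUP x\<in>P s. J x) \<le> (SUP x\<in>(\<Union>s\<in>B. P s). J x)"
      using assms(1,2) by (intro cSUP_least cSUP_subset_mono bd) auto
    show "(SUP x\<in>(\<Union>s\<in>B. P s). J x) \<le> (SUP s\<in>B. SUP x\<in>P s. J x)"
    proof (rule cSUP_least)
      show "(\<Union>s\<in>B. P s) \<noteq> {}" using assms(1,2) by blast
      fix x assume "x \<in> (\<Union>s\<in>B. P s)"
      then obtain s where s: "s \<in> B" "x \<in> P s" by blast
      have "J x \<le> (SUP x\<in>P s. J x)" by (rule cSUP_upper[OF s(2) bd])
      also have "\<dots> \<le> (SUP s\<in>B. SUP x\<in>P s. J x)" by (rule cSUP_upper[OF s(1) bd2])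
      finally show "J x \<le> (SUP s\<in>B. SUP x\<in>P s. J x)" .
    qed
  qed
qed

definition first_then :: "item \<Rightarrow> policy \<Rightarrow> policy \<Rightarrow> policy \<Rightarrow> policy" where
  "first_then s \<pi>T \<pi>F \<pi>0 = (\<lambda>h. case h of [] \<Rightarrow> s
     | (s', y) # h' \<Rightarrow> if s' = s then (if y then \<pi>T h' else \<pi>F h') else \<pi>0 h)"

lemma first_then_simps [simp]:
  "first_then s \<pi>T \<pi>F \<pi>0 [] = s"
  "continue_after (first_then s \<pi>T \<pi>F \<pi>0) (s, True) = \<pi>T"
  "continue_after (first_then s \<pi>T \<pi>F \<pi>0) (s, False) = \<pi>F"
  by (auto simp: first_then_def continue_after_def)

lemma session_bounded:
  assumes "0 \<le> \<gamma>" "\<gamma> < 1" "\<And>s. \<phi> s \<in> {0..1}"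
  obtains K where "\<And>\<pi>. \<bar>session_value \<gamma> \<phi> w \<pi>\<bar> \<le> K"
proof -
  have "\<bar>w s\<bar> \<le> max \<bar>w ItemA\<bar> \<bar>w ItemB\<bar>" for s by (cases s) auto
  then have "\<bar>session_value \<gamma> \<phi> w \<pi>\<bar> \<le> max \<bar>w ItemA\<bar> \<bar>w ItemB\<bar> / (1 - \<gamma>)" for \<pi>
    by (intro session_bound assms)
  then show ?thesis by (rule that)
qed

lemma Q_user_rec:
  assumes \<gamma>: "0 \<le> \<gamma>H" "\<gamma>H < 1" and f: "\<And>s. f \<theta> s \<in> {0..1}"
  shows "Q_user \<alpha> r \<gamma>A \<gamma>H f \<theta> \<mu> s = f \<theta> s * r \<theta> s + \<gamma>H *
     (f \<theta> s * (SUP s'\<in>best_items \<alpha> \<gamma>A f (posterior f \<mu> (s, True)).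
                 Q_user \<alpha> r \<gamma>A \<gamma>H f \<theta> (posterior f \<mu> (s, True)) s') +
      (1 - f \<theta> s) * (SUP s'\<in>best_items \<alpha> \<gamma>A f (posterior f \<mu> (s, False)).
                 Q_user \<alpha> r \<gamma>A \<gamma>H f \<theta> (posterior f \<mu> (s, False)) s'))"
proof -
  let ?J = "session_value \<gamma>H (f \<theta>) (r \<theta>)"
  define B where "B \<mu> = best_items \<alpha> \<gamma>A f \<mu>" for \<mu>
  define P where "P \<mu> s = {\<pi>. \<pi> [] = s \<and> (\<forall>h. h \<noteq> [] \<longrightarrow> \<pi> h \<in> B (posterior_after f \<mu> h))}" for \<mu> s
  define R where "R \<mu> = {\<pi>. \<forall>h. \<pi> h \<in> B (posterior_after f \<mu> h)}" for \<mu>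
  obtain K where K: "\<And>\<pi>. \<bar>?J \<pi>\<bar> \<le> K" by (rule session_bounded[of \<gamma>H "f \<theta>" "r \<theta>"]) (use \<gamma> f in auto)
  have bd: "bdd_above (?J ` X)" for X
    using K by (intro bdd_aboveI2[where M = K]) (meson abs_le_D1)
  have "\<exists>s. s \<in> B \<nu>" for \<nu>
    using best_items_nonempty[of \<alpha> \<gamma>A f \<nu>] by (auto simp: B_def)
  then obtain c where c: "\<And>\<nu>. c \<nu> \<in> B \<nu>" by metis
  have "(\<lambda>h. c (posterior_after f \<nu> h)) \<in> R \<nu>" for \<nu>
    using c by (simp add: R_def)
  then have Rne: "R \<nu> \<noteq> {}" for \<nu> by blast
  have "(\<lambda>h. if h = [] then s' else c (posterior_after f \<nu> h)) \<in> P \<nu> s'" for \<nu> s'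
    using c by (simp add: P_def)
  then have Pne: "P \<nu> s' \<noteq> {}" for \<nu> s' by blast
  have RP: "R \<nu> = (\<Union>s\<in>B \<nu>. P \<nu> s)" for \<nu>
  proof
    show "R \<nu> \<subseteq> (\<Union>s\<in>B \<nu>. P \<nu> s)"
    proof
      fix \<pi> assume "\<pi> \<in> R \<nu>"
      then have "\<pi> h \<in> B (posterior_after f \<nu> h)" for h by (simp add: R_def)
      then show "\<pi> \<in> (\<Union>s\<in>B \<nu>. P \<nu> s)"
        by (auto simp: P_def posterior_after_def)
           (metis foldl_Nil)
    qed
    show "(\<Union>s\<in>B \<nu>. P \<nu> s) \<subseteq> R \<nu>"
      by (auto simp: R_def P_def posterior_after_def) (metis foldl_Nil)
  qed
  have QR: "(SUP s'\<in>B \<nu>. SUP \<pi>\<in>P \<nu> s'. ?J \<pi>) = (SUP \<pi>\<in>R \<nu>. ?J \<pi>)" for \<nu>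
    unfolding RP using best_items_nonempty Pne K by (intro cSUP_split) (auto simp: B_def)
  have after: "posterior_after f \<mu> (o1 # h) = posterior_after f (posterior f \<mu> o1) h" for o1 h
    by (simp add: posterior_after_def)
  let ?T = "posterior f \<mu> (s, True)" and ?F = "posterior f \<mu> (s, False)"
  have f01: "0 \<le> f \<theta> s" "f \<theta> s \<le> 1" using f[of s] by auto
  have "(SUP \<pi>\<in>P \<mu> s. ?J \<pi>) = f \<theta> s * r \<theta> s + \<gamma>H *
     (f \<theta> s * (SUP \<pi>\<in>R ?T. ?J \<pi>) + (1 - f \<theta> s) * (SUP \<pi>\<in>R ?F. ?J \<pi>))" (is "?L = ?Rhs")
  proof (rule antisym)
    show "?L \<le> ?Rhs"
    proof (rule cSUP_least[OF Pne])
      fix \<pi> assume \<pi>: "\<pi> \<in> P \<mu> s"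
      then have s: "\<pi> [] = s" by (simp add: P_def)
      have "continue_after \<pi> (s, y) \<in> R (posterior f \<mu> (s, y))" for y
        using \<pi> by (auto simp: P_def R_def continue_after_def after[symmetric])
      then have "?J (continue_after \<pi> (s, True)) \<le> (SUP \<pi>\<in>R ?T. ?J \<pi>)"
        "?J (continue_after \<pi> (s, False)) \<le> (SUP \<pi>\<in>R ?F. ?J \<pi>)"
        by (auto intro!: cSUP_upper bd)
      then show "?J \<pi> \<le> ?Rhs"
        unfolding session_value_rec[OF \<gamma> f, where \<pi> = \<pi>] s using \<gamma> f01
        by (intro add_left_mono mult_left_mono add_mono) auto
    qed
    have "(\<gamma>H * f \<theta> s) * (SUP \<pi>\<in>R ?T. ?J \<pi>) + (\<gamma>H * (1 - f \<theta> s)) * (SUP \<pi>\<in>R ?F. ?J \<pi>)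
       \<le> ?L - f \<theta> s * r \<theta> s"
    proof (rule weighted_cSup_le)
      fix u v assume "u \<in> ?J ` R ?T" "v \<in> ?J ` R ?F"
      then obtain \<pi>T \<pi>F where u: "u = ?J \<pi>T" "\<pi>T \<in> R ?T" and v: "v = ?J \<pi>F" "\<pi>F \<in> R ?F" by auto
      define \<pi> where "\<pi> = first_then s \<pi>T \<pi>F (\<lambda>h. c (posterior_after f \<mu> h))"
      have "\<pi> \<in> P \<mu> s"
        using u v c by (auto simp: P_def R_def \<pi>_def first_then_def after split: list.splits)
      then have "?J \<pi> \<le> ?L" by (intro cSUP_upper bd)
      then show "(\<gamma>H * f \<theta> s) * u + (\<gamma>H * (1 - f \<theta> s)) * v \<le> ?L - f \<theta> s * r \<theta> s"
        unfolding session_value_rec[OF \<gamma> f, where \<pi> = \<pi>] u v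
        by (simp add: \<pi>_def algebra_simps)
    qed (use Rne \<gamma> f01 in auto)
    then show "?Rhs \<le> ?L" by (simp add: algebra_simps)
  qed
  then show ?thesis
    unfolding QR[symmetric] by (simp add: Q_user_def P_def B_def)
qed

lemma Q_alg_rec:
  assumes \<gamma>: "0 \<le> \<gamma>A" "\<gamma>A < 1" and f: "\<And>\<theta> s. f \<theta> s \<in> {0..1}" and \<mu>: "\<And>\<theta>. 0 \<le> \<mu> \<theta>"
  shows "Q_alg \<alpha> \<gamma>A f \<mu> s =
     (\<Sum>\<theta>\<in>UNIV. \<mu> \<theta> * (f \<theta> s / \<alpha> \<theta> s + \<gamma>A *
        (f \<theta> s * (SUP s'. Q_alg \<alpha> \<gamma>A f (posterior f \<mu> (s, True)) s') +
         (1 - f \<theta> s) * (SUP s'. Q_alg \<alpha> \<gamma>A f (posterior f \<mu> (s, False)) s'))))"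
proof -
  let ?J = "\<lambda>\<theta>. session_value \<gamma>A (f \<theta>) (\<lambda>s'. 1 / \<alpha> \<theta> s')"
  define V where "V \<nu> \<pi> = (\<Sum>\<theta>\<in>UNIV. \<nu> \<theta> * ?J \<theta> \<pi>)" for \<nu> \<pi>
  have "\<exists>K. \<forall>\<pi>. \<bar>?J \<theta> \<pi>\<bar> \<le> K" for \<theta> by (rule session_bounded[of \<gamma>A "f \<theta>" "\<lambda>s'. 1 / \<alpha> \<theta> s'"]) (use \<gamma> f in auto)
  then obtain K where K: "\<And>\<theta> \<pi>. \<bar>?J \<theta> \<pi>\<bar> \<le> K \<theta>" by metis
  have VK: "\<bar>V \<nu> \<pi>\<bar> \<le> (\<Sum>\<theta>\<in>UNIV. \<bar>\<nu> \<theta>\<bar> * K \<theta>)" for \<nu> \<pi>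
    unfolding V_def by (rule order_trans[OF sum_abs]) (auto simp: abs_mult intro!: sum_mono mult_left_mono K)
  have bd: "bdd_above (V \<nu> ` X)" for \<nu> X
    using VK by (intro bdd_aboveI2[where M = "\<Sum>\<theta>\<in>UNIV. \<bar>\<nu> \<theta>\<bar> * K \<theta>"]) (meson abs_le_D1)
  have ex: "\<exists>\<pi>::policy. \<pi> [] = s'" for s' by (rule exI[of _ "\<lambda>_. s'"]) simp
  have QV: "(SUP s'. Q_alg \<alpha> \<gamma>A f \<nu> s') = (SUP \<pi>. V \<nu> \<pi>)" for \<nu>
  proof -
    have "(\<Union>s'. {\<pi>::policy. \<pi> [] = s'}) = UNIV" by auto
    then show ?thesis
      unfolding Q_alg_def V_def[symmetric]
      using cSUP_split[of UNIV "\<lambda>s'. {\<pi>::policy. \<pi> [] = s'}" "V \<nu>", OF _ _ VK] ex by simp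
  qed
  define lik where "lik y \<theta> = (if y then f \<theta> s else 1 - f \<theta> s)" for y \<theta>
  define p where "p y = (\<Sum>\<theta>\<in>UNIV. \<mu> \<theta> * lik y \<theta>)" for y
  have lik0: "0 \<le> lik y \<theta>" for y \<theta> using f[of \<theta> s] by (auto simp: lik_def)
  have p0: "0 \<le> p y" for y unfolding p_def by (intro sum_nonneg mult_nonneg_nonneg \<mu> lik0)
  have norm: "(\<Sum>\<theta>\<in>UNIV. \<mu> \<theta> * lik y \<theta> * ?J \<theta> \<pi>) = p y * V (posterior f \<mu> (s, y)) \<pi>" for y \<pi>
  proof (cases "p y = 0")
    case True
    then have "\<mu> \<theta> * lik y \<theta> = 0" for \<theta>
      unfolding p_def using \<mu> lik0 by (subst (asm) sum_nonneg_eq_0_iff) auto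
    then have "(\<Sum>\<theta>\<in>UNIV. \<mu> \<theta> * lik y \<theta> * ?J \<theta> \<pi>) = 0" by (intro sum.neutral) (simp del: mult_eq_0_iff)
    then show ?thesis using True by simp
  next
    case False
    have "p y * V (posterior f \<mu> (s, y)) \<pi> = (\<Sum>\<theta>\<in>UNIV. p y * (\<mu> \<theta> * lik y \<theta> / p y * ?J \<theta> \<pi>))"
      by (simp add: V_def posterior_def p_def lik_def sum_distrib_left)
    also have "\<dots> = (\<Sum>\<theta>\<in>UNIV. \<mu> \<theta> * lik y \<theta> * ?J \<theta> \<pi>)" using False by (intro sum.cong) auto
    finally show ?thesis by simp
  qed
  define c where "c = (\<Sum>\<theta>\<in>UNIV. \<mu> \<theta> * (f \<theta> s / \<alpha> \<theta> s))"
  have step: "V \<mu> \<pi> = c + \<gamma>A * (p True * V (posterior f \<mu> (s, True)) (continue_after \<pi> (s, True)) +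
      p False * V (posterior f \<mu> (s, False)) (continue_after \<pi> (s, False)))" if "\<pi> [] = s" for \<pi>
  proof -
    have "V \<mu> \<pi> = (\<Sum>\<theta>\<in>UNIV. \<mu> \<theta> * (f \<theta> s / \<alpha> \<theta> s) + \<gamma>A *
       (\<mu> \<theta> * lik True \<theta> * ?J \<theta> (continue_after \<pi> (s, True)) +
        \<mu> \<theta> * lik False \<theta> * ?J \<theta> (continue_after \<pi> (s, False))))"
      unfolding V_def
      by (intro sum.cong refl, subst session_value_rec[OF \<gamma> f])
         (simp add: that lik_def algebra_simps)
    then show ?thesis by (simp add: sum.distrib c_def flip: sum_distrib_left norm)
  qed
  let ?T = "posterior f \<mu> (s, True)" and ?F = "posterior f \<mu> (s, False)"
  have "(SUP \<pi>\<in>{\<pi>. \<pi> [] = s}. V \<mu> \<pi>) = c + \<gamma>A * (p True * (SUP \<pi>. V ?T \<pi>) + p False * (SUP \<pi>. V ?F \<pi>))"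
    (is "?L = ?Rhs")
  proof (rule antisym)
    show "?L \<le> ?Rhs"
    proof (rule cSUP_least)
      fix \<pi> :: policy assume "\<pi> \<in> {\<pi>. \<pi> [] = s}"
      then have "\<pi> [] = s" by simp
      show "V \<mu> \<pi> \<le> ?Rhs"
        unfolding step[of \<pi>, OF \<open>\<pi> [] = s\<close>] using \<gamma> p0
        by (intro add_left_mono mult_left_mono add_mono cSUP_upper bd) auto
    qed (use ex in auto)
    have "(\<gamma>A * p True) * (SUP \<pi>. V ?T \<pi>) + (\<gamma>A * p False) * (SUP \<pi>. V ?F \<pi>) \<le> ?L - c"
    proof (rule weighted_cSup_le)
      fix u v assume "u \<in> range (V ?T)" "v \<in> range (V ?F)"
      then obtain \<pi>T \<pi>F where u: "u = V ?T \<pi>T" and v: "v = V ?F \<pi>F" by auto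
      have "V \<mu> (first_then s \<pi>T \<pi>F \<pi>T) \<le> ?L" by (intro cSUP_upper bd) simp
      then show "(\<gamma>A * p True) * u + (\<gamma>A * p False) * v \<le> ?L - c"
        by (subst (asm) step) (simp_all add: u v algebra_simps)
    qed (use \<gamma> p0 in auto)
    then show "?Rhs \<le> ?L" by (simp add: algebra_simps)
  qed
  then have "Q_alg \<alpha> \<gamma>A f \<mu> s = c + \<gamma>A * (p True * (SUP \<pi>. V ?T \<pi>) + p False * (SUP \<pi>. V ?F \<pi>))"
    by (simp add: Q_alg_def V_def)
  also have "\<dots> = (\<Sum>\<theta>\<in>UNIV. \<mu> \<theta> * (f \<theta> s / \<alpha> \<theta> s) + \<gamma>A *
       ((\<mu> \<theta> * lik True \<theta>) * (SUP \<pi>. V ?T \<pi>) + (\<mu> \<theta> * lik False \<theta>) * (SUP \<pi>. V ?F \<pi>)))"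
    by (simp add: sum.distrib c_def p_def flip: sum_distrib_left sum_distrib_right)
  finally show ?thesis
    unfolding QV by (simp add: lik_def algebra_simps)
qed

end

(* Probing item s, i.e. recommending s until the first missing engagement and the other item ever
   after, is optimal for the algorithm: types that miss s strictly favour the other item, and
   engagement with s only increases the lead of s.  Hence both Bellman recursions close on the sign of
   the linear classifier, and a type earns her ideal value when the classifier favours her
   high-reward item, and otherwise a value monotone in her low-item engagement, with direction
   given by comparing the reward ratio with the discount factor. *)

theory Submission
  imports Defs
begin

lemma contraction_le_zero:
  fixes d :: "'a \<Rightarrow> real"
  assumes \<gamma>: "0 \<le> \<gamma>" "\<gamma> < 1"
    and bound: "\<And>x. x \<in> X \<Longrightarrow> d x \<le> C"
    and step: "\<And>B x. x \<in> X \<Longrightarrow> 0 \<le> B \<Longrightarrow> (\<And>y. y \<in> X \<Longrightarrow> d y \<le> B) \<Longrightarrow> d x \<le> \<gamma> * B"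
    and x: "x \<in> X"
  shows "d x \<le> 0"
proof -
  have iterate: "\<forall>x\<in>X. d x \<le> \<gamma> ^ n * max C 0" for n
  proof (induction n)
    case 0
    show ?case using bound by fastforce
  next
    case (Suc n)
    have "d x \<le> \<gamma> * (\<gamma> ^ n * max C 0)" if "x \<in> X" for x
      using Suc \<gamma> that by (intro step) auto
    then show ?case by (simp add: mult.assoc)
  qed
  have "(\<lambda>n. \<gamma> ^ n * max C 0) \<longlonglongrightarrow> 0 * max C 0"
    using \<gamma> by (intro tendsto_mult LIMSEQ_power_zero tendsto_const) auto
  then show ?thesis using iterate x by (intro LIMSEQ_le_const[of _ 0 "d x"]) auto
qed

lemma other_other [simp]: "other (other s) = s"
  by (cases s) auto

lemma other_neq [simp]: "other s \<noteq> s" "s \<noteq> other s"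
  by (cases s; simp)+

lemma item_eq_cases: "s' = s \<or> s' = other s"
  by (cases s; cases s') auto

lemma UNIV_item: "(UNIV :: item set) = {s, other s}"
  using item_eq_cases by auto

lemma SUP_item:
  fixes g :: "item \<Rightarrow> real"
  shows "(SUP s'. g s') = max (g s) (g (other s))"
  unfolding UNIV_item[of s] by (simp add: cSup_eq_Max)

text \<open>The value of recommending \<open>s\<close> until the first missing engagement and the other item, which
  is then always engaged with, forever after; meaningful only if \<open>\<phi> s = 1\<close> or \<open>\<phi> (other s) = 1\<close>.\<close>

definition probe_value :: "real \<Rightarrow> strategy \<Rightarrow> (item \<Rightarrow> real) \<Rightarrow> item \<Rightarrow> real" where
  "probe_value \<gamma> \<phi> w s =
     (\<phi> s * w s + \<gamma> * (1 - \<phi> s) * (w (other s) / (1 - \<gamma>))) / (1 - \<gamma> * \<phi> s)"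

lemma discounted_less_1:
  fixes \<gamma> x :: real
  assumes "0 \<le> \<gamma>" "\<gamma> < 1" "x \<le> 1"
  shows "\<gamma> * x < 1"
  using mult_left_mono[of x 1 \<gamma>] assms by simp

lemma probe_value_eq_1: "\<phi> s = 1 \<Longrightarrow> probe_value \<gamma> \<phi> w s = w s / (1 - \<gamma>)"
  by (simp add: probe_value_def)

lemma probe_value_rec:
  assumes "0 \<le> \<gamma>" "\<gamma> < 1" "\<phi> s \<le> 1" "\<phi> s < 1 \<Longrightarrow> \<phi> (other s) = 1"
  shows "probe_value \<gamma> \<phi> w s = \<phi> s * w s +
    \<gamma> * (\<phi> s * probe_value \<gamma> \<phi> w s + (1 - \<phi> s) * probe_value \<gamma> \<phi> w (other s))"
proof -
  have tail: "(1 - \<phi> s) * probe_value \<gamma> \<phi> w (other s) = (1 - \<phi> s) * (w (other s) / (1 - \<gamma>))"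
    using assms(3,4) probe_value_eq_1[of \<phi> "other s" \<gamma> w] by (cases "\<phi> s < 1") auto
  have "(1 - \<gamma> * \<phi> s) * probe_value \<gamma> \<phi> w s =
      \<phi> s * w s + \<gamma> * ((1 - \<phi> s) * (w (other s) / (1 - \<gamma>)))"
    using discounted_less_1[OF assms(1-3)] by (simp add: probe_value_def)
  then show ?thesis unfolding tail[symmetric] by (simp add: algebra_simps)
qed

lemma probe_value_less:
  assumes "0 \<le> \<gamma>" "\<gamma> < 1" "\<phi> s \<le> 1" "\<phi> (other s) = 1" "\<phi> s * w s < w (other s)"
  shows "probe_value \<gamma> \<phi> w s < probe_value \<gamma> \<phi> w (other s)"
proof -
  define R where "R = w (other s) / (1 - \<gamma>)"
  have R: "w (other s) = (1 - \<gamma>) * R" using assms by (simp add: R_def)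
  have "\<phi> s * w s + \<gamma> * (1 - \<phi> s) * R < R * (1 - \<gamma> * \<phi> s)"
    using assms(5) unfolding R by (simp add: algebra_simps)
  then have "probe_value \<gamma> \<phi> w s < R"
    using discounted_less_1[OF assms(1-3)] by (simp add: probe_value_def R_def divide_less_eq)
  then show ?thesis using assms(4) by (simp add: probe_value_eq_1 R_def)
qed

definition subbelief :: "('u::finite) belief \<Rightarrow> bool" where
  "subbelief \<mu> \<longleftrightarrow> (\<forall>\<theta>. 0 \<le> \<mu> \<theta>) \<and> (\<Sum>\<theta>\<in>UNIV. \<mu> \<theta>) \<le> 1"

text \<open>In a screening profile a missing engagement with \<open>s\<close> reveals that the other item is strictly
  better for the algorithm and always engaged with.\<close>

locale screening =
  fixes \<alpha> :: "'u::finite \<Rightarrow> item \<Rightarrow> real" and \<gamma>A :: real and f :: "'u profile"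
  assumes discount: "0 \<le> \<gamma>A" "\<gamma>A < 1"
    and f_le_1: "f \<theta> s \<le> 1" and f_nonneg: "0 \<le> f \<theta> s"
    and reveals: "f \<theta> s < 1 \<Longrightarrow> f \<theta> s / \<alpha> \<theta> s < f \<theta> (other s) / \<alpha> \<theta> (other s)"
begin

lemma f_range: "f \<theta> s \<in> {0..1}"
  using f_le_1 f_nonneg by simp

lemma f_other_eq_1: "f \<theta> s < 1 \<Longrightarrow> f \<theta> (other s) = 1"
  using reveals[of \<theta> s] reveals[of \<theta> "other s"] f_le_1[of \<theta> "other s"] by fastforce

definition U :: "'u \<Rightarrow> item \<Rightarrow> real" where
  "U \<theta> s = probe_value \<gamma>A (f \<theta>) (\<lambda>s'. 1 / \<alpha> \<theta> s') s"

lemma U_rec: "U \<theta> s = f \<theta> s / \<alpha> \<theta> s + \<gamma>A * (f \<theta> s * U \<theta> s + (1 - f \<theta> s) * U \<theta> (other s))"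
  using probe_value_rec[of \<gamma>A "f \<theta>" s "\<lambda>s'. 1 / \<alpha> \<theta> s'"] discount f_le_1[of \<theta> s] f_other_eq_1[of \<theta> s]
  by (simp add: U_def)

lemma U_less: "f \<theta> s < 1 \<Longrightarrow> U \<theta> s < U \<theta> (other s)"
  using probe_value_less[of \<gamma>A "f \<theta>" s "\<lambda>s'. 1 / \<alpha> \<theta> s'"] discount f_other_eq_1[of \<theta> s] reveals[of \<theta> s]
  by (simp add: U_def)

lemma miss_U_le: "(1 - f \<theta> s) * (U \<theta> s - U \<theta> (other s)) \<le> 0"
  using U_less[of \<theta> s] f_le_1[of \<theta> s] by (cases "f \<theta> s = 1") (auto intro: mult_nonneg_nonpos)

definition val :: "item \<Rightarrow> 'u belief \<Rightarrow> real" where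
  "val s \<mu> = (\<Sum>\<theta>\<in>UNIV. \<mu> \<theta> * U \<theta> s)"

definition lead :: "item \<Rightarrow> 'u belief \<Rightarrow> real" where
  "lead s \<mu> = val s \<mu> - val (other s) \<mu>"

lemma lead_other: "lead (other s) \<mu> = - lead s \<mu>"
  by (simp add: lead_def)

lemma lead_eq_sum: "lead s \<mu> = (\<Sum>\<theta>\<in>UNIV. \<mu> \<theta> * (U \<theta> s - U \<theta> (other s)))"
  by (simp add: lead_def val_def sum_subtractf algebra_simps)

definition lik :: "item \<Rightarrow> bool \<Rightarrow> 'u \<Rightarrow> real" where
  "lik s y \<theta> = (if y then f \<theta> s else 1 - f \<theta> s)"

definition update :: "'u belief \<Rightarrow> item \<Rightarrow> bool \<Rightarrow> 'u belief" where
  "update \<mu> s y = (\<lambda>\<theta>. \<mu> \<theta> * lik s y \<theta>)"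

lemma lik_nonneg: "0 \<le> lik s y \<theta>"
  using f_range[of \<theta> s] by (auto simp: lik_def)

definition prob :: "'u belief \<Rightarrow> item \<Rightarrow> bool \<Rightarrow> real" where
  "prob \<mu> s y = (\<Sum>\<theta>\<in>UNIV. update \<mu> s y \<theta>)"

lemma posterior_eq: "posterior f \<mu> (s, y) = (\<lambda>\<theta>. update \<mu> s y \<theta> / prob \<mu> s y)"
  by (simp add: posterior_def update_def prob_def lik_def)

lemma update_nonneg: "subbelief \<mu> \<Longrightarrow> 0 \<le> update \<mu> s y \<theta>"
  by (simp add: subbelief_def update_def lik_nonneg)

lemma prob_nonneg: "subbelief \<mu> \<Longrightarrow> 0 \<le> prob \<mu> s y"
  by (simp add: prob_def sum_nonneg update_nonneg)

lemma prob_add: "prob \<mu> s True + prob \<mu> s False = (\<Sum>\<theta>\<in>UNIV. \<mu> \<theta>)"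
  by (simp add: prob_def update_def lik_def algebra_simps flip: sum.distrib)

lemma subbelief_posterior:
  assumes "subbelief \<mu>"
  shows "subbelief (posterior f \<mu> (s, y))"
proof -
  have "(\<Sum>\<theta>\<in>UNIV. posterior f \<mu> (s, y) \<theta>) = prob \<mu> s y / prob \<mu> s y"
    by (simp add: posterior_eq flip: sum_divide_distrib) (simp add: prob_def)
  then show ?thesis
    using update_nonneg[OF assms] prob_nonneg[OF assms] by (auto simp: subbelief_def posterior_eq)
qed

lemma val_posterior: "val s' (posterior f \<mu> (s, y)) = val s' (update \<mu> s y) / prob \<mu> s y"
  by (simp add: val_def posterior_eq sum_divide_distrib)

lemma lead_posterior: "lead s' (posterior f \<mu> (s, y)) = lead s' (update \<mu> s y) / prob \<mu> s y"
  by (simp add: lead_def val_posterior diff_divide_distrib)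

lemma prob_val_posterior:
  assumes "subbelief \<mu>"
  shows "prob \<mu> s y * val s' (posterior f \<mu> (s, y)) = val s' (update \<mu> s y)"
proof (cases "prob \<mu> s y = 0")
  case True
  then have "update \<mu> s y \<theta> = 0" for \<theta>
    unfolding prob_def using update_nonneg[OF assms, of s y] by (subst (asm) sum_nonneg_eq_0_iff) auto
  then show ?thesis using True by (simp add: val_def)
qed (simp add: val_posterior)

lemma lead_update_False:
  assumes "subbelief \<mu>"
  shows "lead s (update \<mu> s False) \<le> 0"
proof -
  have "\<mu> \<theta> * ((1 - f \<theta> s) * (U \<theta> s - U \<theta> (other s))) \<le> 0" for \<theta>
    using assms miss_U_le by (simp add: subbelief_def mult_nonneg_nonpos)
  then show ?thesis
    unfolding lead_eq_sum update_def lik_def by (intro sum_nonpos) (simp add: mult.assoc)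
qed

lemma val_update_add: "val s' (update \<mu> s True) + val s' (update \<mu> s False) = val s' \<mu>"
  by (simp add: val_def update_def lik_def algebra_simps flip: sum.distrib)

lemma lead_update_True:
  assumes "subbelief \<mu>"
  shows "lead s \<mu> \<le> lead s (update \<mu> s True)"
  using lead_update_False[OF assms, of s] val_update_add[of s \<mu> s] val_update_add[of "other s" \<mu> s]
  unfolding lead_def by linarith

definition opt :: "'u belief \<Rightarrow> real" where
  "opt \<mu> = max (val ItemA \<mu>) (val ItemB \<mu>)"

lemma opt_eq: "opt \<mu> = max (val s \<mu>) (val (other s) \<mu>)"
  by (cases s) (auto simp: opt_def)

lemma prob_opt_posterior:
  assumes "subbelief \<mu>"
  shows "prob \<mu> s y * opt (posterior f \<mu> (s, y)) = opt (update \<mu> s y)"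
  using prob_nonneg[OF assms] by (simp add: opt_def max_mult_distrib_left prob_val_posterior[OF assms])

definition payoff :: "'u belief \<Rightarrow> item \<Rightarrow> real" where
  "payoff \<mu> s = (\<Sum>\<theta>\<in>UNIV. \<mu> \<theta> * (f \<theta> s / \<alpha> \<theta> s))"

definition backup :: "'u belief \<Rightarrow> item \<Rightarrow> real" where
  "backup \<mu> s = payoff \<mu> s + \<gamma>A * (opt (update \<mu> s True) + opt (update \<mu> s False))"

lemma val_rec: "val s \<mu> = payoff \<mu> s + \<gamma>A * (val s (update \<mu> s True) + val (other s) (update \<mu> s False))"
proof -
  have "val s \<mu> = (\<Sum>\<theta>\<in>UNIV. \<mu> \<theta> * (f \<theta> s / \<alpha> \<theta> s + \<gamma>A * (f \<theta> s * U \<theta> s + (1 - f \<theta> s) * U \<theta> (other s))))"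
    unfolding val_def by (subst U_rec) simp
  then show ?thesis
    by (simp add: payoff_def val_def update_def lik_def algebra_simps sum.distrib sum_distrib_left
      sum_subtractf)
qed

lemma backup_eq_val:
  assumes "subbelief \<mu>" "0 \<le> lead s \<mu>"
  shows "backup \<mu> s = val s \<mu>"
  using lead_update_True[OF assms(1), of s] lead_update_False[OF assms(1), of s] assms(2)
  unfolding backup_def opt_eq[of _ s] by (subst val_rec) (simp add: lead_def max_def)

lemma backup_less_val:
  assumes \<mu>: "subbelief \<mu>" and neg: "lead s \<mu> < 0"
  shows "backup \<mu> s < val (other s) \<mu>"
proof (cases "0 \<le> lead s (update \<mu> s True)")
  case True
  then have "backup \<mu> s = val s \<mu>"
    using lead_update_False[OF \<mu>, of s]
    unfolding backup_def opt_eq[of _ s] by (subst val_rec) (simp add: lead_def max_def)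
  then show ?thesis using neg by (simp add: lead_def)
next
  case False
  then have "backup \<mu> s = payoff \<mu> s + \<gamma>A * val (other s) \<mu>"
    using lead_update_False[OF \<mu>, of s] val_update_add[of "other s" \<mu> s]
    unfolding backup_def opt_eq[of _ s] by (simp add: lead_def max_def)
  moreover have "payoff \<mu> s + \<gamma>A * val (other s) \<mu> - val (other s) \<mu> =
      (1 - \<gamma>A) * lead s \<mu> + \<gamma>A * lead s (update \<mu> s False)"
  proof -
    have "payoff \<mu> s = val s \<mu> - \<gamma>A * (val s (update \<mu> s True) + val (other s) (update \<mu> s False))"
      using val_rec[of s \<mu>] by simp
    then show ?thesis
      by (simp add: lead_def algebra_simps flip: val_update_add[of _ \<mu> s])
  qed
  moreover have "(1 - \<gamma>A) * lead s \<mu> < 0" using neg discount by (simp add: mult_less_0_iff)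
  moreover have "\<gamma>A * lead s (update \<mu> s False) \<le> 0"
    using lead_update_False[OF \<mu>] discount by (simp add: mult_nonneg_nonpos)
  ultimately show ?thesis by linarith
qed

lemma max_backup_eq_opt:
  assumes "subbelief \<mu>"
  shows "max (backup \<mu> s) (backup \<mu> (other s)) = opt \<mu>"
proof -
  have "max (backup \<mu> t) (backup \<mu> (other t)) = opt \<mu>" if "0 \<le> lead t \<mu>" for t
  proof (cases "lead t \<mu> = 0")
    case True
    then show ?thesis
      using backup_eq_val[OF assms, of t] backup_eq_val[OF assms, of "other t"]
      by (simp add: lead_other opt_eq[of _ t])
  next
    case False
    then show ?thesis
      using backup_eq_val[OF assms, of t] backup_less_val[OF assms, of "other t"] that
      by (simp add: lead_other opt_eq[of _ t] lead_def max_def)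
  qed
  from this[of s] this[of "other s"] show ?thesis
    by (cases "0 \<le> lead s \<mu>") (auto simp: lead_other max.commute)
qed

definition best_value :: "'u belief \<Rightarrow> real" where
  "best_value \<mu> = (SUP s. Q_alg \<alpha> \<gamma>A f \<mu> s)"

lemma Q_alg_eq:
  assumes "subbelief \<mu>"
  shows "Q_alg \<alpha> \<gamma>A f \<mu> s = payoff \<mu> s + \<gamma>A *
    (prob \<mu> s True * best_value (posterior f \<mu> (s, True)) + prob \<mu> s False * best_value (posterior f \<mu> (s, False)))"
proof -
  have "Q_alg \<alpha> \<gamma>A f \<mu> s =
     (\<Sum>\<theta>\<in>UNIV. \<mu> \<theta> * (f \<theta> s / \<alpha> \<theta> s + \<gamma>A *
        (f \<theta> s * best_value (posterior f \<mu> (s, True)) +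
         (1 - f \<theta> s) * best_value (posterior f \<mu> (s, False)))))"
    unfolding best_value_def by (rule Q_alg_rec) (use discount f_range assms in \<open>auto simp: subbelief_def\<close>)
  then show ?thesis
    by (simp add: payoff_def prob_def update_def lik_def algebra_simps sum.distrib sum_distrib_left
      sum_distrib_right sum_subtractf)
qed

lemma Q_alg_bounded: obtains K where "\<And>\<mu> s. subbelief \<mu> \<Longrightarrow> \<bar>Q_alg \<alpha> \<gamma>A f \<mu> s\<bar> \<le> K"
proof -
  let ?J = "\<lambda>\<theta>. session_value \<gamma>A (f \<theta>) (\<lambda>s'. 1 / \<alpha> \<theta> s')"
  have "\<exists>K. \<forall>\<pi>. \<bar>?J \<theta> \<pi>\<bar> \<le> K" for \<theta>
    by (rule session_bounded[of \<gamma>A "f \<theta>" "\<lambda>s'. 1 / \<alpha> \<theta> s'"]) (use discount f_range in auto)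
  then obtain K where K: "\<And>\<theta> \<pi>. \<bar>?J \<theta> \<pi>\<bar> \<le> K \<theta>" by metis
  have "\<bar>Q_alg \<alpha> \<gamma>A f \<mu> s\<bar> \<le> (\<Sum>\<theta>\<in>UNIV. K \<theta>)" if \<mu>: "subbelief \<mu>" for \<mu> s
    unfolding Q_alg_def
  proof (rule cSup_abs_le)
    show "(\<lambda>\<pi>. \<Sum>\<theta>\<in>UNIV. \<mu> \<theta> * ?J \<theta> \<pi>) ` {\<pi>. \<pi> [] = s} \<noteq> {}"
      by (simp add: exI[of _ "\<lambda>_. s"])
    fix v assume "v \<in> (\<lambda>\<pi>. \<Sum>\<theta>\<in>UNIV. \<mu> \<theta> * ?J \<theta> \<pi>) ` {\<pi>. \<pi> [] = s}"
    then obtain \<pi> where v: "v = (\<Sum>\<theta>\<in>UNIV. \<mu> \<theta> * ?J \<theta> \<pi>)" by auto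
    have "\<bar>\<mu> \<theta> * ?J \<theta> \<pi>\<bar> \<le> 1 * K \<theta>" for \<theta>
    proof -
      have "\<mu> \<theta> \<le> (\<Sum>\<theta>\<in>UNIV. \<mu> \<theta>)"
        using \<mu> by (intro member_le_sum) (auto simp: subbelief_def)
      then show ?thesis
        using \<mu> K[of \<theta> \<pi>] unfolding abs_mult subbelief_def by (intro mult_mono) auto
    qed
    then show "\<bar>v\<bar> \<le> (\<Sum>\<theta>\<in>UNIV. K \<theta>)"
      unfolding v by (intro order_trans[OF sum_abs] sum_mono) simp
  qed
  then show ?thesis by (rule that)
qed

lemma best_value_eq_opt:
  assumes "subbelief \<mu>"
  shows "best_value \<mu> = opt \<mu>"
proof -
  define d where "d \<nu> = \<bar>best_value \<nu> - opt \<nu>\<bar>" for \<nu>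
  obtain K where K: "\<And>\<mu> s. subbelief \<mu> \<Longrightarrow> \<bar>Q_alg \<alpha> \<gamma>A f \<mu> s\<bar> \<le> K"
    using Q_alg_bounded by blast
  have "d \<mu> \<le> 0"
  proof (rule contraction_le_zero[OF discount, where X = "Collect subbelief" and d = d])
    show "\<mu> \<in> Collect subbelief" using assms by simp
    fix \<nu> :: "'u belief" assume "\<nu> \<in> Collect subbelief"
    then have \<nu>: "subbelief \<nu>" by simp
    have "\<bar>\<nu> \<theta> * U \<theta> s\<bar> \<le> 1 * \<bar>U \<theta> s\<bar>" for \<theta> s
    proof -
      have "\<nu> \<theta> \<le> (\<Sum>\<theta>\<in>UNIV. \<nu> \<theta>)"
        using \<nu> by (intro member_le_sum) (auto simp: subbelief_def)
      then show ?thesis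
        using \<nu> unfolding abs_mult subbelief_def by (intro mult_right_mono) auto
    qed
    then have "\<bar>val s \<nu>\<bar> \<le> (\<Sum>\<theta>\<in>UNIV. \<bar>U \<theta> s\<bar>)" for s
      unfolding val_def by (intro order_trans[OF sum_abs] sum_mono) simp
    from this[of ItemA] this[of ItemB] K[OF \<nu>, of ItemA] K[OF \<nu>, of ItemB]
    show "d \<nu> \<le> K + (\<Sum>\<theta>\<in>UNIV. \<bar>U \<theta> ItemA\<bar>) + (\<Sum>\<theta>\<in>UNIV. \<bar>U \<theta> ItemB\<bar>)"
      by (simp add: d_def best_value_def SUP_item[of _ ItemA] opt_def)
  next
    fix B and \<nu> :: "'u belief"
    assume "\<nu> \<in> Collect subbelief" and B: "0 \<le> B" "\<And>\<nu>'. \<nu>' \<in> Collect subbelief \<Longrightarrow> d \<nu>' \<le> B"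
    then have \<nu>: "subbelief \<nu>" by simp
    have step: "\<bar>Q_alg \<alpha> \<gamma>A f \<nu> s - backup \<nu> s\<bar> \<le> \<gamma>A * B" for s
    proof -
      have y: "\<bar>prob \<nu> s y * best_value (posterior f \<nu> (s, y)) - opt (update \<nu> s y)\<bar> \<le> prob \<nu> s y * B" for y
      proof -
        have "prob \<nu> s y * d (posterior f \<nu> (s, y)) \<le> prob \<nu> s y * B"
          using B(2) subbelief_posterior[OF \<nu>] prob_nonneg[OF \<nu>] by (intro mult_left_mono) auto
        then show ?thesis
          using prob_nonneg[OF \<nu>]
          by (simp add: d_def abs_mult_pos' right_diff_distrib prob_opt_posterior[OF \<nu>])
      qed
      have "(prob \<nu> s True + prob \<nu> s False) * B \<le> 1 * B"
        unfolding prob_add using \<nu> B(1) by (intro mult_right_mono) (auto simp: subbelief_def)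
      then have "\<bar>(prob \<nu> s True * best_value (posterior f \<nu> (s, True)) - opt (update \<nu> s True)) +
          (prob \<nu> s False * best_value (posterior f \<nu> (s, False)) - opt (update \<nu> s False))\<bar> \<le> B"
        using y[of True] y[of False] by (simp add: algebra_simps)
      then have "\<gamma>A * \<bar>(prob \<nu> s True * best_value (posterior f \<nu> (s, True)) - opt (update \<nu> s True)) +
          (prob \<nu> s False * best_value (posterior f \<nu> (s, False)) - opt (update \<nu> s False))\<bar> \<le> \<gamma>A * B"
        using discount by (intro mult_left_mono)
      then show ?thesis
        using discount by (simp add: abs_mult_pos' Q_alg_eq[OF \<nu>] backup_def algebra_simps)
    qed
    from step[of ItemA] step[of ItemB] show "d \<nu> \<le> \<gamma>A * B"
      using max_backup_eq_opt[OF \<nu>, of ItemA]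
      unfolding d_def best_value_def SUP_item[of _ ItemA] other.simps by linarith
  qed
  then show ?thesis by (simp add: d_def)
qed

lemma Q_alg_eq_backup: "subbelief \<mu> \<Longrightarrow> Q_alg \<alpha> \<gamma>A f \<mu> s = backup \<mu> s"
  by (simp add: Q_alg_eq backup_def best_value_eq_opt subbelief_posterior prob_opt_posterior)

lemma mem_best_items_iff:
  assumes "subbelief \<mu>"
  shows "s \<in> best_items \<alpha> \<gamma>A f \<mu> \<longleftrightarrow> 0 \<le> lead s \<mu>"
proof -
  have "s \<in> best_items \<alpha> \<gamma>A f \<mu> \<longleftrightarrow> backup \<mu> (other s) \<le> backup \<mu> s"
    unfolding best_items_def by (simp add: Q_alg_eq_backup[OF assms]) (metis item_eq_cases order_refl)
  also have "\<dots> \<longleftrightarrow> 0 \<le> lead s \<mu>"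
  proof (cases "0 \<le> lead s \<mu>")
    case True
    then show ?thesis
      using max_backup_eq_opt[OF assms, of s] backup_eq_val[OF assms, of s]
      by (auto simp: lead_def opt_eq[of _ s])
  next
    case False
    then show ?thesis
      using backup_less_val[OF assms, of s] backup_eq_val[OF assms, of "other s"] by (simp add: lead_other)
  qed
  finally show ?thesis .
qed

lemma lead_posterior_True_nonneg:
  assumes "subbelief \<mu>" "0 \<le> lead s \<mu>"
  shows "0 \<le> lead s (posterior f \<mu> (s, True))"
  using lead_update_True[OF assms(1), of s] assms prob_nonneg[OF assms(1)] by (simp add: lead_posterior)

lemma lead_posterior_True_pos:
  assumes "subbelief \<mu>" "0 < lead s \<mu>"
  shows "0 < lead s (posterior f \<mu> (s, True))"
proof -
  have pos: "0 < lead s (update \<mu> s True)" using lead_update_True[OF assms(1), of s] assms by simp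
  have "prob \<mu> s True \<noteq> 0"
  proof
    assume "prob \<mu> s True = 0"
    then have "update \<mu> s True \<theta> = 0" for \<theta>
      unfolding prob_def using update_nonneg[OF assms(1), of s True]
      by (subst (asm) sum_nonneg_eq_0_iff) auto
    then show False using pos by (simp add: lead_eq_sum)
  qed
  then have "0 < prob \<mu> s True" using prob_nonneg[OF assms(1), of s True] by simp
  then show ?thesis using pos by (simp add: lead_posterior)
qed

lemma lead_posterior_False:
  assumes "subbelief \<mu>"
  shows "0 \<le> lead (other s) (posterior f \<mu> (s, False))"
  using lead_update_False[OF assms, of s] prob_nonneg[OF assms, of s False]
  by (simp add: lead_posterior lead_other divide_nonpos_nonneg)

lemma Q_user_eq:
  assumes "0 \<le> \<gamma>H" "\<gamma>H < 1"
  shows "Q_user \<alpha> r \<gamma>A \<gamma>H f \<theta> \<mu> s = f \<theta> s * r \<theta> s + \<gamma>H *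
     (f \<theta> s * Q_entry \<alpha> r \<gamma>A \<gamma>H f \<theta> (posterior f \<mu> (s, True)) +
      (1 - f \<theta> s) * Q_entry \<alpha> r \<gamma>A \<gamma>H f \<theta> (posterior f \<mu> (s, False)))"
  unfolding Q_entry_def by (rule Q_user_rec) (use assms f_range in auto)

lemma finite_items: "finite (X :: item set)"
proof (rule finite_subset)
  show "X \<subseteq> {ItemA, ItemB}" using UNIV_item[of ItemA] by auto
qed simp

lemma Q_user_le_Q_entry:
  assumes "s \<in> best_items \<alpha> \<gamma>A f \<mu>"
  shows "Q_user \<alpha> r \<gamma>A \<gamma>H f \<theta> \<mu> s \<le> Q_entry \<alpha> r \<gamma>A \<gamma>H f \<theta> \<mu>"
  unfolding Q_entry_def using assms finite_items by (intro cSUP_upper) auto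

lemma Q_entry_le:
  assumes "\<And>s. Q_user \<alpha> r \<gamma>A \<gamma>H f \<theta> \<mu> s \<le> B"
  shows "Q_entry \<alpha> r \<gamma>A \<gamma>H f \<theta> \<mu> \<le> B"
  unfolding Q_entry_def using assms best_items_nonempty by (intro cSUP_least)

lemma Q_entry_bounded:
  assumes "0 \<le> \<gamma>H" "\<gamma>H < 1"
  obtains K where "\<And>\<mu>. \<bar>Q_entry \<alpha> r \<gamma>A \<gamma>H f \<theta> \<mu>\<bar> \<le> K"
proof -
  obtain K where K: "\<And>\<pi>. \<bar>session_value \<gamma>H (f \<theta>) (r \<theta>) \<pi>\<bar> \<le> K"
    by (rule session_bounded[of \<gamma>H "f \<theta>" "r \<theta>"]) (use assms f_range in auto)
  define c where "c \<nu> = (SOME s. s \<in> best_items \<alpha> \<gamma>A f \<nu>)" for \<nu>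
  have c: "c \<nu> \<in> best_items \<alpha> \<gamma>A f \<nu>" for \<nu>
    unfolding c_def using best_items_nonempty by (metis some_in_eq)
  have user: "\<bar>Q_user \<alpha> r \<gamma>A \<gamma>H f \<theta> \<mu> s\<bar> \<le> K" for \<mu> s
  proof -
    define P where
      "P = {\<pi>. \<pi> [] = s \<and> (\<forall>h. h \<noteq> [] \<longrightarrow> \<pi> h \<in> best_items \<alpha> \<gamma>A f (posterior_after f \<mu> h))}"
    have "(\<lambda>h. if h = [] then s else c (posterior_after f \<mu> h)) \<in> P"
      using c by (simp add: P_def)
    then have "P \<noteq> {}" by (metis empty_iff)
    then show ?thesis
      unfolding Q_user_def P_def[symmetric] using K by (intro cSup_abs_le) auto
  qed
  have "\<bar>Q_entry \<alpha> r \<gamma>A \<gamma>H f \<theta> \<mu>\<bar> \<le> K" for \<mu>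
    unfolding Q_entry_def using user best_items_nonempty[of \<alpha> \<gamma>A f \<mu>] by (intro cSup_abs_le) auto
  then show ?thesis by (rule that)
qed

context
  fixes r :: "'u \<Rightarrow> item \<Rightarrow> real" and \<gamma>H :: real and \<theta> :: 'u and s :: item
  assumes discount_user: "0 \<le> \<gamma>H" "\<gamma>H < 1"
    and engages: "f \<theta> s = 1"
    and prefers: "f \<theta> (other s) * r \<theta> (other s) < r \<theta> s"
begin

lemma Q_entry_le_ideal: "Q_entry \<alpha> r \<gamma>A \<gamma>H f \<theta> \<mu> \<le> r \<theta> s / (1 - \<gamma>H)"
proof -
  define R where "R = r \<theta> s / (1 - \<gamma>H)"
  have R: "r \<theta> s = (1 - \<gamma>H) * R" using discount_user by (simp add: R_def)
  let ?Q = "Q_entry \<alpha> r \<gamma>A \<gamma>H f \<theta>"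
  obtain K where K: "\<And>\<mu>. \<bar>?Q \<mu>\<bar> \<le> K" using Q_entry_bounded[OF discount_user] by blast
  have "?Q \<mu> - R \<le> 0"
  proof (rule contraction_le_zero[OF discount_user, where X = UNIV and d = "\<lambda>\<mu>. ?Q \<mu> - R"])
    show "?Q \<nu> - R \<le> K - R" for \<nu> using K[of \<nu>] by simp
  next
    fix B \<nu> assume "0 \<le> B" and B: "\<And>\<nu>'. \<nu>' \<in> UNIV \<Longrightarrow> ?Q \<nu>' - R \<le> B"
    have "Q_user \<alpha> r \<gamma>A \<gamma>H f \<theta> \<nu> s' \<le> (1 - \<gamma>H) * R + \<gamma>H * (R + B)" for s'
    proof -
      have "f \<theta> s' * ?Q (posterior f \<nu> (s', True)) + (1 - f \<theta> s') * ?Q (posterior f \<nu> (s', False))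
          \<le> f \<theta> s' * (R + B) + (1 - f \<theta> s') * (R + B)"
        using B f_nonneg f_le_1 by (intro add_mono mult_left_mono) (auto simp: algebra_simps)
      also have "\<dots> = R + B" by (simp add: algebra_simps)
      finally have cont: "f \<theta> s' * ?Q (posterior f \<nu> (s', True)) +
          (1 - f \<theta> s') * ?Q (posterior f \<nu> (s', False)) \<le> R + B" .
      have "f \<theta> s' * r \<theta> s' \<le> (1 - \<gamma>H) * R"
        using item_eq_cases[of s' s] engages prefers by (auto simp: R[symmetric])
      then show ?thesis
        unfolding Q_user_eq[OF discount_user]
        by (intro add_mono mult_left_mono[OF cont]) (simp_all add: discount_user)
    qed
    then have "?Q \<nu> \<le> (1 - \<gamma>H) * R + \<gamma>H * (R + B)" by (rule Q_entry_le)
    then show "?Q \<nu> - R \<le> \<gamma>H * B" by (simp add: algebra_simps)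
  qed simp
  then show ?thesis by (simp add: R_def)
qed

lemma Q_entry_eq_ideal:
  assumes "subbelief \<mu>" "0 \<le> lead s \<mu>"
  shows "Q_entry \<alpha> r \<gamma>A \<gamma>H f \<theta> \<mu> = r \<theta> s / (1 - \<gamma>H)"
proof -
  define R where "R = r \<theta> s / (1 - \<gamma>H)"
  have R: "r \<theta> s = (1 - \<gamma>H) * R" using discount_user by (simp add: R_def)
  let ?Q = "Q_entry \<alpha> r \<gamma>A \<gamma>H f \<theta>" and ?X = "{\<mu>. subbelief \<mu> \<and> 0 \<le> lead s \<mu>}"
  obtain K where K: "\<And>\<mu>. \<bar>?Q \<mu>\<bar> \<le> K" using Q_entry_bounded[OF discount_user] by blast
  have "R - ?Q \<mu> \<le> 0"
  proof (rule contraction_le_zero[OF discount_user, where X = ?X and d = "\<lambda>\<mu>. R - ?Q \<mu>"])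
    show "R - ?Q \<nu> \<le> R + K" for \<nu> using K[of \<nu>] by simp
  next
    fix B \<nu> assume \<nu>: "\<nu> \<in> ?X" and "0 \<le> B" and B: "\<And>\<nu>'. \<nu>' \<in> ?X \<Longrightarrow> R - ?Q \<nu>' \<le> B"
    have "posterior f \<nu> (s, True) \<in> ?X"
      using \<nu> subbelief_posterior lead_posterior_True_nonneg by simp
    then have "\<gamma>H * (R - B) \<le> \<gamma>H * ?Q (posterior f \<nu> (s, True))"
      using B[of "posterior f \<nu> (s, True)"] discount_user by (intro mult_left_mono) auto
    moreover have "Q_user \<alpha> r \<gamma>A \<gamma>H f \<theta> \<nu> s \<le> ?Q \<nu>"
      using \<nu> by (intro Q_user_le_Q_entry) (simp add: mem_best_items_iff)
    ultimately show "R - ?Q \<nu> \<le> \<gamma>H * B"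
      unfolding Q_user_eq[OF discount_user] engages R by (simp add: algebra_simps)
  qed (use assms in simp)
  then show ?thesis using Q_entry_le_ideal[of \<mu>] by (simp add: R_def)
qed

lemma Q_entry_eq_probe_value:
  assumes "subbelief \<mu>" "lead s \<mu> < 0"
  shows "Q_entry \<alpha> r \<gamma>A \<gamma>H f \<theta> \<mu> = probe_value \<gamma>H (f \<theta>) (r \<theta>) (other s)"
proof -
  define v where "v = probe_value \<gamma>H (f \<theta>) (r \<theta>) (other s)"
  define x where "x = f \<theta> (other s)"
  define R where "R = r \<theta> s / (1 - \<gamma>H)"
  have x: "0 \<le> x" "x \<le> 1" using f_nonneg f_le_1 by (simp_all add: x_def)
  have v: "v = x * r \<theta> (other s) + \<gamma>H * (x * v + (1 - x) * R)"
    using probe_value_rec[of \<gamma>H "f \<theta>" "other s" "r \<theta>"] probe_value_eq_1[of "f \<theta>" s \<gamma>H "r \<theta>"]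
      discount_user x engages by (simp add: v_def x_def R_def)
  let ?Q = "Q_entry \<alpha> r \<gamma>A \<gamma>H f \<theta>" and ?X = "{\<mu>. subbelief \<mu> \<and> lead s \<mu> < 0}"
  obtain K where K: "\<And>\<mu>. \<bar>?Q \<mu>\<bar> \<le> K" using Q_entry_bounded[OF discount_user] by blast
  have "\<bar>?Q \<mu> - v\<bar> \<le> 0"
  proof (rule contraction_le_zero[OF discount_user, where X = ?X and d = "\<lambda>\<mu>. \<bar>?Q \<mu> - v\<bar>"])
    show "\<bar>?Q \<nu> - v\<bar> \<le> K + \<bar>v\<bar>" for \<nu> using K[of \<nu>] by simp
  next
    fix B \<nu> assume \<nu>: "\<nu> \<in> ?X" and "0 \<le> B" and B: "\<And>\<nu>'. \<nu>' \<in> ?X \<Longrightarrow> \<bar>?Q \<nu>' - v\<bar> \<le> B"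
    let ?T = "posterior f \<nu> (other s, True)" and ?F = "posterior f \<nu> (other s, False)"
    have "best_items \<alpha> \<gamma>A f \<nu> = {other s}"
      using \<nu> mem_best_items_iff[of \<nu> s] mem_best_items_iff[of \<nu> "other s"]
      by (auto simp: lead_other) (metis item_eq_cases)
    then have "?Q \<nu> = x * r \<theta> (other s) + \<gamma>H * (x * ?Q ?T + (1 - x) * ?Q ?F)"
      using Q_user_eq[OF discount_user, of r \<theta> \<nu> "other s"] by (simp add: Q_entry_def[of _ _ _ _ _ _ \<nu>] x_def)
    moreover have "?Q ?F = R"
      unfolding R_def using \<nu> subbelief_posterior lead_posterior_False[of \<nu> "other s"]
      by (intro Q_entry_eq_ideal) auto
    ultimately have "?Q \<nu> - v = (\<gamma>H * x) * (?Q ?T - v)"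
      by (subst v) (simp add: algebra_simps)
    then have "\<bar>?Q \<nu> - v\<bar> = (\<gamma>H * x) * \<bar>?Q ?T - v\<bar>"
      using discount_user x by (simp add: abs_mult)
    also have "\<dots> \<le> (\<gamma>H * 1) * B"
    proof (rule mult_mono)
      have "?T \<in> ?X"
        using \<nu> subbelief_posterior lead_posterior_True_pos[of \<nu> "other s"] by (simp add: lead_other)
      then show "\<bar>?Q ?T - v\<bar> \<le> B" by (rule B)
    qed (use discount_user x in \<open>auto intro: mult_left_mono mult_left_le\<close>)
    finally show "\<bar>?Q \<nu> - v\<bar> \<le> \<gamma>H * B" by simp
  qed (use assms in simp)
  then show ?thesis by (simp add: v_def)
qed

end

lemma U_diff_eq_classifier_weight: "U \<theta> ItemA - U \<theta> ItemB = classifier_weight \<alpha> \<gamma>A f \<theta>"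
proof -
  have g: "\<gamma>A * f \<theta> s < 1" for s using discounted_less_1 discount f_le_1 by blast
  consider "f \<theta> ItemA = 1" | "f \<theta> ItemB = 1"
    using f_other_eq_1[of \<theta> ItemA] f_le_1[of \<theta> ItemA] by fastforce
  then show ?thesis
    by cases (use g[of ItemA] g[of ItemB] discount in
      \<open>simp_all add: U_def probe_value_def classifier_weight_def divide_simps, simp_all add: algebra_simps\<close>)
qed

lemma lead_ItemA_eq_margin:
  "lead ItemA \<mu> = classifier_weight \<alpha> \<gamma>A f \<theta> * \<mu> \<theta> + margin \<alpha> \<gamma>A \<mu> f \<theta>"
proof -
  have "lead ItemA \<mu> = (\<Sum>\<theta>'\<in>UNIV. classifier_weight \<alpha> \<gamma>A f \<theta>' * \<mu> \<theta>')"
    by (simp add: lead_eq_sum U_diff_eq_classifier_weight mult.commute)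
  then show ?thesis by (simp add: margin_def sum.remove[of UNIV \<theta>])
qed

lemma slack1_eq_lead:
  assumes "f \<theta> ItemB = 1"
  shows "slack1 \<alpha> \<gamma>A \<mu> f \<theta> (f \<theta> ItemA) = (1 - \<gamma>A * f \<theta> ItemA) * lead ItemB \<mu>"
proof -
  have "(1 - \<gamma>A * f \<theta> ItemA) * classifier_weight \<alpha> \<gamma>A f \<theta> = f \<theta> ItemA / \<alpha> \<theta> ItemA - 1 / \<alpha> \<theta> ItemB"
    using assms discount discounted_less_1[OF discount f_le_1[of \<theta> ItemA]]
    by (simp add: classifier_weight_def)
  then have "(1 - \<gamma>A * f \<theta> ItemA) * (classifier_weight \<alpha> \<gamma>A f \<theta> * \<mu> \<theta>) =
      (f \<theta> ItemA / \<alpha> \<theta> ItemA - 1 / \<alpha> \<theta> ItemB) * \<mu> \<theta>"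
    by (simp flip: mult.assoc)
  moreover have lead: "lead ItemB \<mu> = - (classifier_weight \<alpha> \<gamma>A f \<theta> * \<mu> \<theta>) - margin \<alpha> \<gamma>A \<mu> f \<theta>"
    using lead_other[of ItemA \<mu>] lead_ItemA_eq_margin[of \<mu> \<theta>] by simp
  ultimately show ?thesis by (simp add: slack1_def lead algebra_simps)
qed

lemma slack2_eq_lead:
  assumes "f \<theta> ItemA = 1"
  shows "slack2 \<alpha> \<gamma>A \<mu> f \<theta> (f \<theta> ItemB) = (1 - \<gamma>A * f \<theta> ItemB) * lead ItemA \<mu>"
proof -
  have "(1 - \<gamma>A * f \<theta> ItemB) * classifier_weight \<alpha> \<gamma>A f \<theta> = 1 / \<alpha> \<theta> ItemA - f \<theta> ItemB / \<alpha> \<theta> ItemB"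
    using assms discount discounted_less_1[OF discount f_le_1[of \<theta> ItemB]]
    by (simp add: classifier_weight_def)
  then have "(1 - \<gamma>A * f \<theta> ItemB) * (classifier_weight \<alpha> \<gamma>A f \<theta> * \<mu> \<theta>) =
      (1 / \<alpha> \<theta> ItemA - f \<theta> ItemB / \<alpha> \<theta> ItemB) * \<mu> \<theta>"
    by (simp flip: mult.assoc)
  then show ?thesis
    by (simp add: slack2_def lead_ItemA_eq_margin[of \<mu> \<theta>] algebra_simps)
qed

end

lemma margin_fun_upd: "margin \<alpha> \<gamma>A \<mu> (f(\<theta> := \<phi>)) \<theta> = margin \<alpha> \<gamma>A \<mu> f \<theta>"
  unfolding margin_def by (rule sum.cong) (auto simp: classifier_weight_def)

lemma unsteered_value_less_iff:
  fixes \<gamma> x x' rl rh :: real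
  assumes \<gamma>: "0 \<le> \<gamma>" "\<gamma> < 1" and x: "x \<le> 1" "x' \<le> 1"
  defines "v \<equiv> \<lambda>x. (x * rl + \<gamma> * (1 - x) * (rh / (1 - \<gamma>))) / (1 - \<gamma> * x)"
  shows "v x < v x' \<longleftrightarrow> 0 < (x' - x) * (rl - \<gamma> * rh)"
proof -
  define R where "R = rh / (1 - \<gamma>)"
  have R: "rh = (1 - \<gamma>) * R" using \<gamma> by (simp add: R_def)
  have pos: "0 < 1 - \<gamma> * x" "0 < 1 - \<gamma> * x'" using discounted_less_1[OF \<gamma>] x by (simp_all add: less_diff_eq)
  have "v x < v x' \<longleftrightarrow>
      (x * rl + \<gamma> * (1 - x) * R) * (1 - \<gamma> * x') < (x' * rl + \<gamma> * (1 - x') * R) * (1 - \<gamma> * x)"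
    using pos by (simp add: v_def R_def[symmetric] divide_less_eq less_divide_eq mult.commute mult.left_commute)
  also have "\<dots> \<longleftrightarrow> 0 < (x' - x) * (rl - \<gamma> * rh)"
    unfolding R by (simp add: algebra_simps)
  finally show ?thesis .
qed

text \<open>A type's best response depends on her low-item engagement \<open>x\<close> only: steering the algorithm
  (\<open>S x\<close>) yields the ideal value \<open>R\<close>, and otherwise the value is monotone in \<open>x\<close>.\<close>

lemma best_response_iff:
  fixes X :: "real set" and S :: "real \<Rightarrow> bool" and \<gamma> rl rh :: real
  assumes \<gamma>: "0 \<le> \<gamma>" "\<gamma> < 1" and rh: "0 < rh" "rl < rh"
    and X: "X \<subseteq> {0..1}" "0 \<in> X" "1 \<in> X" and x: "x \<in> X"
  defines "R \<equiv> rh / (1 - \<gamma>)"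
  defines "v \<equiv> \<lambda>x. (x * rl + \<gamma> * (1 - x) * R) / (1 - \<gamma> * x)"
  defines "u \<equiv> \<lambda>x. if S x then R else v x"
  shows "(\<forall>x'\<in>X. u x' \<le> u x) \<longleftrightarrow>
    (if \<exists>x'\<in>X. S x' then S x else (\<gamma> > rl / rh \<longrightarrow> x = 0) \<and> (\<gamma> < rl / rh \<longrightarrow> x = 1))"
proof (cases "\<exists>x'\<in>X. S x'")
  case True
  have less: "v x' < R" if x': "x' \<in> X" for x'
  proof -
    have b: "0 \<le> x'" "x' \<le> 1" using X x' by auto
    have "x' * rl < rh"
    proof (cases "0 \<le> rl")
      case True
      then show ?thesis using mult_right_mono[of x' 1 rl] b rh by simp
    next
      case False
      then show ?thesis using mult_nonneg_nonpos[of x' rl] b rh by simp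
    qed
    then show ?thesis
      using probe_value_less[of \<gamma> "\<lambda>s. if s = ItemA then x' else 1" ItemA "\<lambda>s. if s = ItemA then rl else rh"]
        \<gamma> b by (simp add: probe_value_def v_def R_def)
  qed
  have "u x' \<le> R" if "x' \<in> X" for x' using less[OF that] by (simp add: u_def)
  moreover have "u x' = R \<longleftrightarrow> S x'" if "x' \<in> X" for x' using less[OF that] by (auto simp: u_def)
  ultimately have "(\<forall>x'\<in>X. u x' \<le> u x) \<longleftrightarrow> S x"
    using True x by (metis antisym)
  then show ?thesis using True by simp
next
  case False
  have cmp: "u x' \<le> u x \<longleftrightarrow> (x' - x) * (rl - \<gamma> * rh) \<le> 0" if "x' \<in> X" for x'
  proof -
    have "x \<le> 1" "x' \<le> 1" using X x that by auto
    from unsteered_value_less_iff[OF \<gamma> this, of rl rh] have "v x < v x' \<longleftrightarrow> 0 < (x' - x) * (rl - \<gamma> * rh)"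
      unfolding v_def R_def .
    then show ?thesis using False x that by (auto simp: u_def not_less[symmetric])
  qed
  have "(\<forall>x'\<in>X. u x' \<le> u x) \<longleftrightarrow> (\<forall>x'\<in>X. (x' - x) * (rl - \<gamma> * rh) \<le> 0)"
    using cmp by simp
  also have "\<dots> \<longleftrightarrow> (\<gamma> > rl / rh \<longrightarrow> x = 0) \<and> (\<gamma> < rl / rh \<longrightarrow> x = 1)"
  proof -
    have sgn: "\<gamma> > rl / rh \<longleftrightarrow> rl - \<gamma> * rh < 0" "\<gamma> < rl / rh \<longleftrightarrow> 0 < rl - \<gamma> * rh"
      using rh by (simp_all add: divide_less_eq less_divide_eq)
    have b: "0 \<le> x'" "x' \<le> 1" if "x' \<in> X" for x' using X that by auto
    consider "rl - \<gamma> * rh < 0" | "0 < rl - \<gamma> * rh" | "rl - \<gamma> * rh = 0" by linarith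
    then show ?thesis
    proof cases
      case 1
      then have "(x' - x) * (rl - \<gamma> * rh) \<le> 0 \<longleftrightarrow> x \<le> x'" for x' by (auto simp: mult_le_0_iff)
      then show ?thesis using sgn 1 b x X(2) by (auto intro: antisym)
    next
      case 2
      then have "(x' - x) * (rl - \<gamma> * rh) \<le> 0 \<longleftrightarrow> x' \<le> x" for x' by (auto simp: mult_le_0_iff)
      then show ?thesis using sgn 2 b x X(3) by (auto intro: antisym)
    qed (use sgn in simp)
  qed
  finally show ?thesis using False by simp
qed

theorem theorem5p1:
  fixes \<Theta>1 \<Theta>2 :: "'u::finite set"
    and \<alpha> r f :: "'u \<Rightarrow> item \<Rightarrow> real"
    and \<mu> :: "'u \<Rightarrow> real"
    and \<gamma>A \<gamma>H :: real
  assumes partition: "\<Theta>1 \<union> \<Theta>2 = UNIV" "\<Theta>1 \<inter> \<Theta>2 = {}"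
    and alpha_pos: "\<And>\<theta> s. 0 < \<alpha> \<theta> s"
    and longer_a: "\<And>\<theta>. 1 / \<alpha> \<theta> ItemA > 1 / \<alpha> \<theta> ItemB"
    and type1: "\<And>\<theta>. \<theta> \<in> \<Theta>1 \<Longrightarrow> r \<theta> ItemA < r \<theta> ItemB"
    and type2: "\<And>\<theta>. \<theta> \<in> \<Theta>2 \<Longrightarrow> r \<theta> ItemA > r \<theta> ItemB"
    and high_reward_pos: "\<And>\<theta>. 0 < r \<theta> (high_item r \<theta>)"
    and discount_alg: "0 \<le> \<gamma>A" "\<gamma>A < 1"
    and discount_user: "0 \<le> \<gamma>H" "\<gamma>H < 1"
    and prior: "\<And>\<theta>. 0 \<le> \<mu> \<theta>" "(\<Sum>\<theta>\<in>UNIV. \<mu> \<theta>) = 1"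
  shows "AE_equilibrium \<alpha> r \<gamma>A \<gamma>H \<mu> f \<longleftrightarrow>
    (\<forall>\<theta>. admissible \<alpha> r \<theta> (f \<theta>)) \<and>
    (\<forall>\<theta>. let x = f \<theta> (low_item r \<theta>);
             F = steerable \<Theta>1 \<alpha> \<gamma>A \<mu> f \<theta>;
             \<rho> = r \<theta> (low_item r \<theta>) / r \<theta> (high_item r \<theta>)
         in f \<theta> (high_item r \<theta>) = 1 \<and>
            (F \<noteq> {} \<longrightarrow> x \<in> F \<or> (\<theta> \<in> \<Theta>1 \<and> x = 1 \<and> 0 \<le> slack1 \<alpha> \<gamma>A \<mu> f \<theta> 1)) \<and>
            (F = {} \<and> \<gamma>H > \<rho> \<longrightarrow> x = 0) \<and>
            (F = {} \<and> \<gamma>H < \<rho> \<longrightarrow> x = 1) \<and>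
            (F = {} \<and> \<gamma>H = \<rho> \<longrightarrow> x \<in> {0..1}))"
proof -
  have longer: "\<alpha> \<theta> ItemA < \<alpha> \<theta> ItemB" for \<theta>
    using longer_a[of \<theta>] alpha_pos[of \<theta> ItemA] alpha_pos[of \<theta> ItemB] by (simp add: field_simps)
  have notin1: "\<theta> \<notin> \<Theta>1 \<longleftrightarrow> \<theta> \<in> \<Theta>2" for \<theta> using partition by auto
  have high: "high_item r \<theta> = (if \<theta> \<in> \<Theta>1 then ItemB else ItemA)" for \<theta>
    using type1[of \<theta>] type2[of \<theta>] notin1[of \<theta>] by (auto simp: high_item_def)
  have low: "low_item r \<theta> = (if \<theta> \<in> \<Theta>1 then ItemA else ItemB)" for \<theta>
    by (simp add: high)
  have low_less: "r \<theta> (low_item r \<theta>) < r \<theta> (high_item r \<theta>)" for \<theta>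
    using type1[of \<theta>] type2[of \<theta>] notin1[of \<theta>] by (auto simp: high)
  define X where "X \<theta> = (if \<theta> \<in> \<Theta>1 then {0..<\<alpha> \<theta> ItemA / \<alpha> \<theta> ItemB} \<union> {1} else {0..1})" for \<theta>
  have ratio: "\<alpha> \<theta> ItemA / \<alpha> \<theta> ItemB < 1" "0 < \<alpha> \<theta> ItemA / \<alpha> \<theta> ItemB" "1 < \<alpha> \<theta> ItemB / \<alpha> \<theta> ItemA" for \<theta>
    using longer[of \<theta>] alpha_pos[of \<theta>] by simp_all
  have all_item: "(\<forall>s. P s) \<longleftrightarrow> P ItemA \<and> P ItemB" for P :: "item \<Rightarrow> bool"
    by (metis item.exhaust)
  have adm: "admissible \<alpha> r \<theta> \<phi> \<longleftrightarrow> \<phi> (high_item r \<theta>) = 1 \<and> \<phi> (low_item r \<theta>) \<in> X \<theta>" for \<theta> \<phi>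
    using ratio[of \<theta>] by (auto simp: admissible_def X_def high all_item)
  have X: "X \<theta> \<subseteq> {0..1}" "0 \<in> X \<theta>" "1 \<in> X \<theta>" for \<theta>
    using ratio[of \<theta>] by (auto simp: X_def)
  have sub: "subbelief \<mu>" using prior by (simp add: subbelief_def)
  define slack where "slack g \<theta> x = (if \<theta> \<in> \<Theta>1 then slack1 \<alpha> \<gamma>A \<mu> g \<theta> x else slack2 \<alpha> \<gamma>A \<mu> g \<theta> x)"
    for g :: "'u profile" and \<theta> x
  have slack_upd: "slack (g(\<theta> := \<phi>)) \<theta> = slack g \<theta>" for g \<theta> \<phi>
    by (simp add: fun_eq_iff slack_def slack1_def slack2_def margin_fun_upd)
  define u where "u \<theta> x =
    (if 0 \<le> slack f \<theta> x then r \<theta> (high_item r \<theta>) / (1 - \<gamma>H)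
     else (x * r \<theta> (low_item r \<theta>) + \<gamma>H * (1 - x) * (r \<theta> (high_item r \<theta>) / (1 - \<gamma>H))) / (1 - \<gamma>H * x))" for \<theta> x
  have entry: "Q_entry \<alpha> r \<gamma>A \<gamma>H g \<theta> \<mu> =
    (if 0 \<le> slack g \<theta> (g \<theta> (low_item r \<theta>)) then r \<theta> (high_item r \<theta>) / (1 - \<gamma>H)
     else probe_value \<gamma>H (g \<theta>) (r \<theta>) (low_item r \<theta>))"
    if g: "\<And>\<theta>. admissible \<alpha> r \<theta> (g \<theta>)" for g \<theta>
  proof -
    interpret screening \<alpha> \<gamma>A g
    proof
      fix \<theta> s
      have gX: "g \<theta> (high_item r \<theta>) = 1" "g \<theta> (low_item r \<theta>) \<in> X \<theta>" using g[of \<theta>] by (simp_all add: adm)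
      have "g \<theta> s \<in> {0..1}" using gX X(1)[of \<theta>] item_eq_cases[of s "high_item r \<theta>"] by auto
      then show "g \<theta> s \<le> 1" "0 \<le> g \<theta> s" by simp_all
      assume less: "g \<theta> s < 1"
      then have s: "s = low_item r \<theta>" using gX item_eq_cases[of s "high_item r \<theta>"] by auto
      show "g \<theta> s / \<alpha> \<theta> s < g \<theta> (other s) / \<alpha> \<theta> (other s)"
      proof (cases "\<theta> \<in> \<Theta>1")
        case True
        then have "g \<theta> ItemA < \<alpha> \<theta> ItemA / \<alpha> \<theta> ItemB" using gX less s by (auto simp: X_def low high)
        then show ?thesis
          using True s gX alpha_pos[of \<theta> ItemA] alpha_pos[of \<theta> ItemB] by (simp add: low high field_simps)
      next
        case False
        have "g \<theta> ItemB / \<alpha> \<theta> ItemB < 1 / \<alpha> \<theta> ItemB"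
          using less s False alpha_pos[of \<theta> ItemB] by (simp add: low divide_strict_right_mono)
        then show ?thesis using False s gX longer_a[of \<theta>] by (simp add: low high)
      qed
    qed (use discount_alg in auto)
    have gX: "g \<theta> (high_item r \<theta>) = 1" "g \<theta> (low_item r \<theta>) \<in> X \<theta>" using g[of \<theta>] by (simp_all add: adm)
    have prefers: "g \<theta> (low_item r \<theta>) * r \<theta> (low_item r \<theta>) < r \<theta> (high_item r \<theta>)"
    proof (cases "0 \<le> r \<theta> (low_item r \<theta>)")
      case True
      then show ?thesis
        using mult_right_mono[OF f_le_1[of \<theta> "low_item r \<theta>"]] low_less[of \<theta>] by fastforce
    next
      case False
      then show ?thesis
        using mult_nonneg_nonpos[OF f_nonneg[of \<theta> "low_item r \<theta>"], of "r \<theta> (low_item r \<theta>)"]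
          high_reward_pos[of \<theta>] by simp
    qed
    note user = Q_entry_eq_ideal[where s = "high_item r \<theta>" and r = r and \<theta> = \<theta>, OF discount_user gX(1) prefers sub]
      Q_entry_eq_probe_value[where s = "high_item r \<theta>" and r = r and \<theta> = \<theta>, OF discount_user gX(1) prefers sub]
    have "slack g \<theta> (g \<theta> (low_item r \<theta>)) =
        (1 - \<gamma>A * g \<theta> (low_item r \<theta>)) * lead (high_item r \<theta>) \<mu>"
      using gX(1) slack1_eq_lead[of \<theta> \<mu>] slack2_eq_lead[of \<theta> \<mu>]
      by (simp add: slack_def high split: if_splits)
    then have "0 \<le> slack g \<theta> (g \<theta> (low_item r \<theta>)) \<longleftrightarrow> 0 \<le> lead (high_item r \<theta>) \<mu>"
      using discounted_less_1[OF discount_alg f_le_1[of \<theta> "low_item r \<theta>"]] by (simp add: zero_le_mult_iff)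
    then show ?thesis using user by simp
  qed
  have best: "(\<forall>\<phi>. admissible \<alpha> r \<theta> \<phi> \<longrightarrow>
        Q_entry \<alpha> r \<gamma>A \<gamma>H (f(\<theta> := \<phi>)) \<theta> \<mu> \<le> Q_entry \<alpha> r \<gamma>A \<gamma>H f \<theta> \<mu>) \<longleftrightarrow>
      (\<forall>x'\<in>X \<theta>. u \<theta> x' \<le> u \<theta> (f \<theta> (low_item r \<theta>)))" (is "?L \<longleftrightarrow> ?R")
    if f: "\<And>\<theta>. admissible \<alpha> r \<theta> (f \<theta>)" for \<theta>
  proof -
    have dev: "Q_entry \<alpha> r \<gamma>A \<gamma>H (f(\<theta> := \<phi>)) \<theta> \<mu> = u \<theta> (\<phi> (low_item r \<theta>))"
      if \<phi>: "admissible \<alpha> r \<theta> \<phi>" for \<phi>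
    proof -
      have "admissible \<alpha> r \<theta>' ((f(\<theta> := \<phi>)) \<theta>')" for \<theta>' using f \<phi> by simp
      then show ?thesis using entry[of "f(\<theta> := \<phi>)" \<theta>] by (simp add: slack_upd u_def probe_value_def)
    qed
    have base: "Q_entry \<alpha> r \<gamma>A \<gamma>H f \<theta> \<mu> = u \<theta> (f \<theta> (low_item r \<theta>))" using dev[OF f] by simp
    show ?thesis
    proof
      assume L: ?L
      show ?R
      proof
        fix x' assume x': "x' \<in> X \<theta>"
        define \<phi> where "\<phi> = (\<lambda>s. if s = high_item r \<theta> then 1 else x')"
        have "admissible \<alpha> r \<theta> \<phi>" using x' by (simp add: adm \<phi>_def)
        then show "u \<theta> x' \<le> u \<theta> (f \<theta> (low_item r \<theta>))" using L dev base by (force simp: \<phi>_def)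
      qed
    qed (use dev base adm in auto)
  qed
  have steer: "steerable \<Theta>1 \<alpha> \<gamma>A \<mu> f \<theta> =
      {x \<in> X \<theta>. 0 \<le> slack f \<theta> x} - (if \<theta> \<in> \<Theta>1 then {1} else {})" for \<theta>
    using ratio[of \<theta>] by (auto simp: steerable_def X_def slack_def)
  have ex_steer: "(\<exists>x\<in>X \<theta>. 0 \<le> slack f \<theta> x) \<longleftrightarrow> steerable \<Theta>1 \<alpha> \<gamma>A \<mu> f \<theta> \<noteq> {}" for \<theta>
  proof
    assume "\<exists>x\<in>X \<theta>. 0 \<le> slack f \<theta> x"
    then obtain x where x: "x \<in> X \<theta>" "0 \<le> slack f \<theta> x" by blast
    show "steerable \<Theta>1 \<alpha> \<gamma>A \<mu> f \<theta> \<noteq> {}"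
    proof (cases "\<theta> \<in> \<Theta>1 \<and> x = 1")
      case True
      let ?m = "margin \<alpha> \<gamma>A \<mu> f \<theta>"
      have gap: "\<mu> \<theta> / \<alpha> \<theta> ItemB \<le> \<mu> \<theta> / \<alpha> \<theta> ItemA"
        using prior(1)[of \<theta>] mult_left_mono[OF less_imp_le[OF longer_a[of \<theta>]]] by simp
      then have "(1 - \<gamma>A) * ?m \<le> 0" using x True by (simp add: slack_def slack1_def algebra_simps)
      then have "?m \<le> 0" using discount_alg by (simp add: mult_le_0_iff)
      moreover have "0 \<le> \<mu> \<theta> / \<alpha> \<theta> ItemB" using prior(1) less_imp_le[OF alpha_pos] by simp
      ultimately have "0 \<le> slack f \<theta> 0" using True by (simp add: slack_def slack1_def)
      then have "0 \<in> steerable \<Theta>1 \<alpha> \<gamma>A \<mu> f \<theta>" unfolding steer using X(2) by simp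
      then show ?thesis by blast
    next
      case False
      then show ?thesis unfolding steer using x by auto
    qed
  qed (auto simp: steer)
  have response: "(\<forall>x'\<in>X \<theta>. u \<theta> x' \<le> u \<theta> (f \<theta> (low_item r \<theta>))) \<longleftrightarrow>
      (if steerable \<Theta>1 \<alpha> \<gamma>A \<mu> f \<theta> \<noteq> {} then 0 \<le> slack f \<theta> (f \<theta> (low_item r \<theta>))
       else (\<gamma>H > r \<theta> (low_item r \<theta>) / r \<theta> (high_item r \<theta>) \<longrightarrow> f \<theta> (low_item r \<theta>) = 0) \<and>
            (\<gamma>H < r \<theta> (low_item r \<theta>) / r \<theta> (high_item r \<theta>) \<longrightarrow> f \<theta> (low_item r \<theta>) = 1))"
    if "f \<theta> (low_item r \<theta>) \<in> X \<theta>" for \<theta>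
    unfolding u_def ex_steer[symmetric]
    by (rule best_response_iff[OF discount_user high_reward_pos low_less X that])
  have steered: "0 \<le> slack f \<theta> (f \<theta> (low_item r \<theta>)) \<longleftrightarrow>
      f \<theta> (low_item r \<theta>) \<in> steerable \<Theta>1 \<alpha> \<gamma>A \<mu> f \<theta> \<or>
      (\<theta> \<in> \<Theta>1 \<and> f \<theta> (low_item r \<theta>) = 1 \<and> 0 \<le> slack1 \<alpha> \<gamma>A \<mu> f \<theta> 1)"
    if "f \<theta> (low_item r \<theta>) \<in> X \<theta>" for \<theta>
    using that by (auto simp: steer slack_def)
  show ?thesis
  proof (cases "\<forall>\<theta>. admissible \<alpha> r \<theta> (f \<theta>)")
    case True
    then have fX: "f \<theta> (high_item r \<theta>) = 1" "f \<theta> (low_item r \<theta>) \<in> X \<theta>" for \<theta>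
      by (simp_all add: adm)
    have f01: "f \<theta> (low_item r \<theta>) \<in> {0..1}" for \<theta> using fX(2) X(1) by blast
    have "AE_equilibrium \<alpha> r \<gamma>A \<gamma>H \<mu> f \<longleftrightarrow>
        (\<forall>\<theta>. \<forall>x'\<in>X \<theta>. u \<theta> x' \<le> u \<theta> (f \<theta> (low_item r \<theta>)))"
      unfolding AE_equilibrium_def using True best by auto
    then show ?thesis
      unfolding Let_def response[OF fX(2)] steered[OF fX(2)] using True fX(1) f01 by auto
  next
    case False
    then show ?thesis by (simp only: AE_equilibrium_def simp_thms)
  qed
qed

end
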